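(* There exists a minimal weakly mixing topological dynamical system $(X,T)$ without any multiply minimal points. In fact, for every $x\in X$, the point $(x,x)$ is a transitive point of $(X\times X, T\times T^2)$ but is not a minimal point of $(X\times X,T\times T^2)$.
   Context: A topological dynamical system (t.d.s.) is a pair $(X,T)$ with $X$ a compact metric space and $T:X\to X$ a homeomorphism. $(X,T)$ is minimal if every orbit $\{T^nx:n\in\mathbb Z\}$ is dense; it is weakly mixing if $(X\times X,T\times T)$ is transitive (for any nonempty open $U,V$ there is $n$ with $U\cap T^{-n}V\neq\emptyset$). A point is transitive if its orbit is dense; a point $z$ is minimal if the restriction of the map to the orbit closure of $z$ is a minimal system. For $d\in\mathbb N$ let $\tau_d=T\times T^2\times\cdots\times T^d$ acting on $X^d$, and $x^{(d)}=(x,\dots,x)\in X^d$. A point $x$ is called multiply minimal if $x^{(d)}$ is a minimal point of $(X^d,\tau_d)$; here "without any multiply minimal points" means there is no $x\in X$ with $(x,x)$ a minimal point of $T\times T^2$. *)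

theory Defs
  imports "HOL-Analysis.Analysis"
begin

definition tds :: "'a::metric_space set \<Rightarrow> ('a \<Rightarrow> 'a) \<Rightarrow> bool" where
  "tds X T \<longleftrightarrow> compact X \<and> X \<noteq> {} \<and> (\<exists>S. homeomorphism X X T S)"

definition iterz :: "'a set \<Rightarrow> ('a \<Rightarrow> 'a) \<Rightarrow> int \<Rightarrow> 'a \<Rightarrow> 'a" where
  "iterz X T n = (if 0 \<le> n then T ^^ nat n else inv_into X T ^^ nat (- n))"

definition orbit :: "'a set \<Rightarrow> ('a \<Rightarrow> 'a) \<Rightarrow> 'a \<Rightarrow> 'a set" where
  "orbit X T x = range (\<lambda>n::int. iterz X T n x)"

definition minimal_system :: "'a::metric_space set \<Rightarrow> ('a \<Rightarrow> 'a) \<Rightarrow> bool" where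
  "minimal_system X T \<longleftrightarrow> tds X T \<and> (\<forall>x\<in>X. closure (orbit X T x) = X)"

definition top_transitive :: "'a::metric_space set \<Rightarrow> ('a \<Rightarrow> 'a) \<Rightarrow> bool" where
  "top_transitive X T \<longleftrightarrow> (\<forall>U V. openin (top_of_set X) U \<and> openin (top_of_set X) V
      \<and> U \<noteq> {} \<and> V \<noteq> {} \<longrightarrow> (\<exists>n::int. U \<inter> {y\<in>X. iterz X T n y \<in> V} \<noteq> {}))"

definition weakly_mixing :: "'a::metric_space set \<Rightarrow> ('a \<Rightarrow> 'a) \<Rightarrow> bool" where
  "weakly_mixing X T \<longleftrightarrow> tds X T \<and> top_transitive (X \<times> X) (\<lambda>(x, y). (T x, T y))"

definition transitive_point :: "'a::metric_space set \<Rightarrow> ('a \<Rightarrow> 'a) \<Rightarrow> 'a \<Rightarrow> bool" where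
  "transitive_point X T z \<longleftrightarrow> z \<in> X \<and> closure (orbit X T z) = X"

definition minimal_point :: "'a::metric_space set \<Rightarrow> ('a \<Rightarrow> 'a) \<Rightarrow> 'a \<Rightarrow> bool" where
  "minimal_point X T z \<longleftrightarrow> z \<in> X \<and>
     (\<forall>y\<in>closure (orbit X T z). closure (orbit X T y) = closure (orbit X T z))"

definition prod_map_12 :: "('a \<Rightarrow> 'a) \<Rightarrow> 'a \<times> 'a \<Rightarrow> 'a \<times> 'a" where
  "prod_map_12 T = (\<lambda>(x, y). (T x, (T ^^ 2) y))"

end

theory Submission
  imports Defs "HOL-Real_Asymp.Real_Asymp"
begin

text \<open>
  Let \<open>G\<close> be the group of affine maps \<open>t \<mapsto> 2\<^sup>h t + b\<close> with \<open>b\<close> rational and \<open>h\<close> an integer. In \<open>G\<close> the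
  translation \<open>T\<close> by \<open>1\<close> and the homothety \<open>g\<close> satisfy \<open>g T g\<^sup>-\<^sup>1 = T\<^sup>2\<close>, so for every \<open>G\<close>-subshift \<open>X\<close> the
  graph of \<open>g\<close> is a closed set invariant under \<open>T \<times> T\<^sup>2\<close>; if \<open>X\<close> is not a point, it is a proper subset
  of \<open>X \<times> X\<close>, and then no transitive point of \<open>T \<times> T\<^sup>2\<close> is minimal. It remains to find \<open>X\<close> in which
  every diagonal point is transitive for \<open>T \<times> T\<^sup>2\<close>; minimality and weak mixing follow from this.

  \<open>X\<close> is a decreasing intersection of strongly irreducible \<open>G\<close>-subshifts. Given such a subshift \<open>S\<close> and
  patterns \<open>u\<close>, \<open>v\<close> occurring in it, pass to the points of \<open>S\<close> for which every coset \<open>p\<langle>T\<rangle>\<close> can be cut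
  into blocks of bounded length carrying copies of \<open>u\<close> at positions \<open>A\<close> and of \<open>v\<close> at positions \<open>B\<close> such
  that \<open>2A - B\<close> covers the block: the origin \<open>m = 2a - b\<close> then sees \<open>u\<close> at \<open>m + n\<close> and \<open>v\<close> at
  \<open>m + 2n\<close> for \<open>n = a - m\<close>. Such sets \<open>A\<close>, \<open>B\<close> can be chosen so sparse that blocks on neighbouring
  cosets can be filled one after the other without conflict, and therefore the smaller subshift is
  again strongly irreducible.
\<close>

section \<open>Sparse sets with \<open>2A - B\<close> covering an interval\<close>

text \<open>Double counting of the pairs \<open>(m, c)\<close> with \<open>G m c\<close>: on average
  \<open>c\<close> is good for a fraction \<open>1 / q\<close> of \<open>U\<close>, and some
  \<open>c\<close> is at least average.\<close>

lemma greedy_cover_step: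
  fixes U :: "'a set" and C :: "'b set"
  assumes fin: "finite U" "finite C" and q: "0 < q"
    and C0: "C \<noteq> {}"
    and deg: "\<And>m. m \<in> U \<Longrightarrow> real (card C) \<le> q * real (card {c\<in>C. G m c})"
  shows "\<exists>c\<in>C. real (card {m\<in>U. \<not> G m c}) \<le> (1 - 1/q) * real (card U)"
proof (rule ccontr)
  assume neg: "\<not> ?thesis"
  have part: "real (card {m\<in>U. G m c}) + real (card {m\<in>U. \<not> G m c}) = real (card U)" for c
  proof -
    have "card U = card ({m\<in>U. G m c} \<union> {m\<in>U. \<not> G m c})"
      by (rule arg_cong[where f=card]) auto
    also have "\<dots> = card {m\<in>U. G m c} + card {m\<in>U. \<not> G m c}"
      using fin by (intro card_Un_disjoint) auto
    finally show ?thesis by simp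
  qed
  have small: "q * real (card {m\<in>U. G m c}) < real (card U)" if "c \<in> C" for c
  proof -
    have "(1 - 1/q) * real (card U) < real (card {m\<in>U. \<not> G m c})"
      using neg that by (meson not_le)
    then have "real (card {m\<in>U. G m c}) < real (card U) / q"
      using part[of c] q by (simp add: left_diff_distrib)
    then show ?thesis using q by (simp add: field_simps)
  qed
  have dbl: "(\<Sum>c\<in>C. card {m\<in>U. G m c}) = (\<Sum>m\<in>U. card {c\<in>C. G m c})"
    using sum.swap_restrict[OF fin(2,1), of "\<lambda>_ _. 1::nat" "\<lambda>c m. G m c"] by simp
  have "real (card U) * real (card C) = (\<Sum>m\<in>U. real (card C))" by simp
  also have "\<dots> \<le> (\<Sum>m\<in>U. q * real (card {c\<in>C. G m c}))"
    by (rule sum_mono) (rule deg)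
  also have "\<dots> = q * real (\<Sum>c\<in>C. card {m\<in>U. G m c})"
    unfolding dbl by (simp add: sum_distrib_left)
  also have "\<dots> = (\<Sum>c\<in>C. q * real (card {m\<in>U. G m c}))"
    by (simp add: sum_distrib_left)
  also have "\<dots> < (\<Sum>c\<in>C. real (card U))"
    using fin(2) C0 small by (intro sum_strict_mono) auto
  finally show False by (simp add: mult.commute)
qed

text \<open>Bernoulli's inequality for the inverse \<open>1 + 1 / (q - 1)\<close> of
  \<open>1 - 1 / q\<close>.\<close>

lemma one_minus_inverse_power_le_half:
  fixes q :: nat
  assumes "1 \<le> q"
  shows "(1 - 1 / real q) ^ q \<le> 1/2"
proof (cases "q = 1")
  case True then show ?thesis by simp
next
  case False
  then have q: "2 \<le> q" using assms by simp
  have "2 \<le> 1 + real q * (1 / (real q - 1))" using q by (simp add: field_simps)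
  also have "\<dots> \<le> (1 + 1 / (real q - 1)) ^ q"
    using q by (intro Bernoulli_inequality) (auto simp: field_simps)
  finally have B: "2 \<le> (1 + 1 / (real q - 1)) ^ q" .
  have e: "1 - 1 / real q = inverse (1 + 1 / (real q - 1))"
    using q by (simp add: field_simps)
  show ?thesis unfolding e power_inverse using B
    by (metis inverse_eq_divide le_imp_inverse_le zero_less_numeral)
qed

text \<open>After \<open>q * k\<close> greedy rounds fewer than \<open>card U / 2 ^ k < 1\<close>
  elements are left uncovered, since \<open>q\<close> rounds at least halve their number. The slack
  \<open>q * (2 * w * q * k)\<close> in the degree pays for the candidates lost to
  separation.\<close>

lemma separated_cover:
  fixes U :: "'a set" and C :: "int set" and w q k :: nat
  assumes fin: "finite U" "finite C" and q: "1 \<le> q" and U: "card U < 2 ^ k"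
    and deg: "\<And>m. m \<in> U \<Longrightarrow> card C + q * (2 * w * q * k) \<le> q * card {c\<in>C. G m c}"
    and C0: "2 * w * q * k < card C"
  obtains C' where "C' \<subseteq> C" "card C' \<le> q * k" "\<And>m. m \<in> U \<Longrightarrow> \<exists>c\<in>C'. G m c"
    "\<And>c c'. c \<in> C' \<Longrightarrow> c' \<in> C' \<Longrightarrow> c \<noteq> c' \<Longrightarrow> int w \<le> \<bar>c - c'\<bar>"
proof -
  have "\<exists>D\<subseteq>C. card D \<le> n \<and> (\<forall>c\<in>D. \<forall>c'\<in>D. c \<noteq> c' \<longrightarrow> int w \<le> \<bar>c - c'\<bar>) \<and>
      real (card {m\<in>U. \<forall>c\<in>D. \<not> G m c}) \<le> (1 - 1 / real q) ^ n * real (card U)"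
    if "n \<le> q * k" for n using that
  proof (induction n)
    case 0
    show ?case by (rule exI[of _ "{}"]) auto
  next
    case (Suc n)
    then obtain D where D: "D \<subseteq> C" "card D \<le> n"
      "\<forall>c\<in>D. \<forall>c'\<in>D. c \<noteq> c' \<longrightarrow> int w \<le> \<bar>c - c'\<bar>"
      "real (card {m\<in>U. \<forall>c\<in>D. \<not> G m c}) \<le> (1 - 1 / real q) ^ n * real (card U)"
      by auto
    have finD: "finite D" using D(1) fin finite_subset by blast
    \<comment> \<open>Candidates too close to the points chosen so far; each of these points costs
      at most \<open>2 * w\<close> candidates.\<close>
    define X where "X = (\<Union>c\<in>D. {c - int w <..< c + int w})"
    have "card X \<le> (\<Sum>c\<in>D. card {c - int w <..< c + int w})"
      unfolding X_def by (rule card_UN_le[OF finD])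
    also have "\<dots> \<le> (\<Sum>c\<in>D. 2 * w)" by (rule sum_mono) auto
    also have "\<dots> \<le> (q * k) * (2 * w)" using D(2) Suc.prems by simp
    finally have cX: "card X \<le> 2 * w * q * k" by (simp add: ac_simps)
    have finX: "finite X" unfolding X_def using finD by auto
    define U' where "U' = {m\<in>U. \<forall>c\<in>D. \<not> G m c}"
    have deg': "real (card (C - X)) \<le> real q * real (card {c\<in>C - X. G m c})" if "m \<in> U'" for m
    proof -
      have "card {c\<in>C. G m c} \<le> card ({c\<in>C - X. G m c} \<union> X)"
        using fin finX by (intro card_mono) auto
      also have "\<dots> \<le> card {c\<in>C - X. G m c} + card X" by (rule card_Un_le)
      finally have "q * card {c\<in>C. G m c} \<le> q * card {c\<in>C - X. G m c} + q * (2 * w * q * k)"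
        using mult_le_mono2[of _ _ q] cX by (simp add: add_mult_distrib2[symmetric])
      then have "card C \<le> q * card {c\<in>C - X. G m c}" using deg[of m] that by (auto simp: U'_def)
      moreover have "card (C - X) \<le> card C" using fin by (intro card_mono) auto
      ultimately show ?thesis by (metis le_trans of_nat_le_iff of_nat_mult)
    qed
    have "C - X \<noteq> {}"
    proof
      assume "C - X = {}" then have "card C \<le> card X" using finX by (intro card_mono) auto
      then show False using cX C0 by simp
    qed
    from greedy_cover_step[of U' "C - X" "real q" G, OF _ _ _ this deg']
    obtain c where c: "c \<in> C - X" "real (card {m\<in>U'. \<not> G m c}) \<le> (1 - 1 / real q) * real (card U')"
      using fin q by (auto simp: U'_def)
    have "{m\<in>U. \<forall>c\<in>insert c D. \<not> G m c} = {m\<in>U'. \<not> G m c}" by (auto simp: U'_def)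
    moreover have "(1 - 1 / real q) * real (card U') \<le> (1 - 1 / real q) ^ Suc n * real (card U)"
      using D(4) q by (simp add: U'_def mult.assoc mult_left_mono)
    ultimately have "real (card {m\<in>U. \<forall>c\<in>insert c D. \<not> G m c}) \<le> (1 - 1 / real q) ^ Suc n * real (card U)"
      using c(2) by simp
    moreover have "card (insert c D) \<le> Suc n" using D(2) finD by (simp add: card_insert_if)
    moreover have far: "int w \<le> \<bar>c - c'\<bar>" if "c' \<in> D" for c'
    proof -
      have "c \<notin> {c' - int w <..< c' + int w}" using c(1) that by (auto simp: X_def)
      then show ?thesis by auto
    qed
    moreover have "int w \<le> \<bar>c' - c\<bar>" if "c' \<in> D" for c' using far[OF that] by linarith
    ultimately show ?case using D(1,3) c(1) by (intro exI[of _ "insert c D"]) auto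
  qed
  from this[OF order_refl] obtain D where D: "D \<subseteq> C" "card D \<le> q * k"
      "\<forall>c\<in>D. \<forall>c'\<in>D. c \<noteq> c' \<longrightarrow> int w \<le> \<bar>c - c'\<bar>"
      "real (card {m\<in>U. \<forall>c\<in>D. \<not> G m c}) \<le> (1 - 1 / real q) ^ (q * k) * real (card U)" by auto
  have "(1 - 1 / real q) ^ (q * k) * real (card U) \<le> (1/2) ^ k * real (card U)"
    unfolding power_mult using one_minus_inverse_power_le_half[OF q] q
    by (intro mult_right_mono power_mono) auto
  also have "\<dots> < (1/2) ^ k * 2 ^ k" using U by (intro mult_strict_left_mono) (auto simp: of_nat_less_numeral_power_cancel_iff)
  also have "\<dots> = 1" by (simp flip: power_mult_distrib)
  finally have "card {m\<in>U. \<forall>c\<in>D. \<not> G m c} = 0" using D(4) by linarith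
  then have "{m\<in>U. \<forall>c\<in>D. \<not> G m c} = {}" using fin by simp
  then show ?thesis using D by (intro that[of D]) auto
qed

text \<open>Lets \<open>N = 2 ^ k\<close> in \<open>sparse_pair_cover\<close> dominate the cube of a
  quantity linear in \<open>k + 1\<close>.\<close>

lemma exp_beats_cube: "\<exists>k::nat. C * (k + 1) ^ 3 \<le> 2 ^ k" for C :: nat
proof -
  have "eventually (\<lambda>k::nat. real C * (real k + 1) ^ 3 \<le> 2 ^ k) at_top"
    by real_asymp
  then obtain k where "real C * (real k + 1) ^ 3 \<le> 2 ^ k" by (auto simp: eventually_at_top_linorder)
  then have "real (C * (k + 1) ^ 3) \<le> real (2 ^ k)" by (simp add: add.commute)
  then show ?thesis by (intro exI[of _ k]) linarith
qed

text \<open>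
  \<open>A\<close> lives in the middle of the interval and \<open>B\<close> in its two outer eighths. A greedy choice of few residue
  classes modulo \<open>w d\<close> for \<open>A\<close> gives every \<open>m\<close> many candidates \<open>b = 2a - m\<close> off \<open>X\<close>, and a second greedy
  choice picks few of them. The point is the order of quantifiers: the forbidden set \<open>X\<close> is arbitrary
  and may have \<open>M\<close> times as many elements as are allowed for \<open>A\<close> and \<open>B\<close> together.
\<close>

definition pair_cover :: "nat \<Rightarrow> nat \<Rightarrow> int \<Rightarrow> int set \<Rightarrow> int set \<Rightarrow> int set \<Rightarrow> bool" where
  "pair_cover w K l X A B \<longleftrightarrow> A \<subseteq> {0..<l} - X \<and> B \<subseteq> {0..<l} - X \<and> A \<inter> B = {} \<and> card A + card B \<le> K \<and>
     (\<forall>m\<in>{0..<l}. \<exists>a\<in>A. \<exists>b\<in>B. 2 * a = m + b) \<and>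
     (\<forall>x\<in>A \<union> B. \<forall>y\<in>A \<union> B. x \<noteq> y \<longrightarrow> int w \<le> \<bar>x - y\<bar>)"

lemma sparse_pair_cover:
  fixes M w :: nat
  assumes w1: "1 \<le> w" and M1: "1 \<le> M"
  obtains L K :: nat where "0 < L"
    "\<And>l X. int L \<le> l \<Longrightarrow> l < 2 * int L \<Longrightarrow> X \<subseteq> {0..<l} \<Longrightarrow> card X \<le> M * K \<Longrightarrow>
      \<exists>A B. pair_cover w K l X A B"
proof -
  define P where "P = 2048 * w * M"
  define c where "c = 4 * P"
  have P1: "2048 \<le> P" "2048 * w \<le> P" using w1 M1 by (auto simp: P_def)
  have c1: "1 \<le> c" using P1 by (simp add: c_def)
  obtain k where k: "(4096 * w * c * P) ^ 3 * (k + 1) ^ 3 \<le> 2 ^ k" using exp_beats_cube by blast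
  \<comment> \<open>Since \<open>l < 2 * N = 2 ^ n\<close>, \<open>n\<close> halvings exhaust
    \<open>{0..<l}\<close>.\<close>
  define n where "n = k + 1"
  define d where "d = c * n"
  define N :: nat where "N = 2 ^ k"
  \<comment> \<open>\<open>z\<close> dominates the products of parameters below, so that the single
    inequality \<open>z * z * z \<le> N\<close> yields all later size conditions.\<close>
  define z where "z = 4096 * w * c * P * n"
  \<comment> \<open>A forbidden set of size \<open>M * K\<close> has at most
    \<open>N / (1024 * w)\<close> elements, too few to spoil half of the candidates.\<close>
  define K where "K = N div (1024 * w * M)"
  \<comment> \<open>Every \<open>m\<close> will keep at least a fraction \<open>1 / q\<close> of the
    possible \<open>b\<close>.\<close>
  define q where "q = 1024 * w * d"
  have n1: "1 \<le> n" by (simp add: n_def)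
  have d1: "1 \<le> d" using c1 n1 by (simp add: d_def)
  have z3: "z * z * z \<le> N"
  proof -
    have "z * z * z = (4096 * w * c * P) ^ 3 * (k + 1) ^ 3"
      unfolding z_def n_def power_mult_distrib power3_eq_cube by (simp only: ac_simps)
    then show ?thesis using k by (simp add: N_def)
  qed
  have zwd: "4096 * (w * d) * P = z" by (simp add: z_def d_def ac_simps)
  have zwd': "4096 * (w * d) \<le> z"
    using P1 mult_le_mono2[of 1 P "4096 * (w * d)"] by (simp add: zwd)
  have znP: "4096 * (n * P) \<le> z"
    using w1 c1 mult_le_mono2[of 1 "w * c" "4096 * (n * P)"] by (simp add: z_def ac_simps)
  have zwn: "w * n \<le> z"
    using c1 P1 mult_le_mono2[of 1 "4096 * c * P" "w * n"] by (simp add: z_def ac_simps)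
  have wd0: "1 \<le> w * d" using w1 d1 by (simp add: Suc_le_eq)
  have zbig: "4096 \<le> z" using zwd' wd0 by linarith
  have zz: "z \<le> z * z" using zbig by simp
  have zN2: "z * z \<le> N"
  proof -
    have "z * z * 1 \<le> z * z * z" using zbig by (intro mult_le_mono) auto
    then show ?thesis using z3 by linarith
  qed
  then have zN: "z \<le> N" "z * z \<le> N" using zz by linarith+
  have fI: "q * (2 * w * q * n) \<le> N"
  proof -
    have "2 ^ 3 * (q * (2 * w * q * n)) = (4096 * (w * d)) * (4096 * (w * d)) * (w * n)"
      by (simp add: q_def ac_simps)
    also have "\<dots> \<le> z * z * z" by (intro mult_le_mono zwd' zwn)
    finally show ?thesis using z3 by simp
  qed
  have fP: "P * (2 * n + q * n) \<le> N"
  proof -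
    have "4 * (P * (q * n)) = (4096 * (w * d)) * (n * P)" by (simp add: q_def ac_simps)
    also have "\<dots> \<le> z * z" using znP by (intro mult_le_mono zwd') simp
    finally have 1: "4 * (P * (q * n)) \<le> N" using zN by simp
    have "4 * (P * (2 * n)) \<le> N" using znP zN by (simp add: ac_simps)
    then show ?thesis using 1 by (simp add: algebra_simps)
  qed
  have KN: "K * (1024 * w * M) \<le> N" unfolding K_def by (rule div_times_less_eq_dividend)
  show ?thesis
  proof (rule that[of N K])
    show "0 < N" by (simp add: N_def)
    fix l :: int and X :: "int set"
    assume l: "int N \<le> l" "l < 2 * int N" and X: "X \<subseteq> {0..<l}" "card X \<le> M * K"
    have finX: "finite X" using X(1) finite_subset by blast
    define wd where "wd = int w * int d"
    have wd1: "1 \<le> wd" using wd0 unfolding wd_def by (metis of_nat_1 of_nat_le_iff of_nat_mult)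
    have wdN: "4096 * wd \<le> int N"
    proof -
      have "4096 * (w * d) \<le> N" using zwd' zN by simp
      then show ?thesis unfolding wd_def by (metis of_nat_le_iff of_nat_mult of_nat_numeral)
    qed
    have wle: "int w \<le> wd" using w1 d1 by (simp add: wd_def mult_le_cancel_left1)
    define s where "s = l div 32"
    define t where "t = s div wd - 1"
    have s4: "64 * wd \<le> s" "l \<le> 64 * s" using wdN l wd1 unfolding s_def by linarith+
    have twd: "wd * (t + 1) \<le> s" "s \<le> 2 * (wd * t)"
    proof -
      obtain p r where pr: "p = wd * (s div wd)" "r = s mod wd" by blast
      have "p + r = s" by (simp add: pr)
      moreover have "0 \<le> r" "r < wd" using wd1 by (auto simp: pr)
      ultimately have le: "p \<le> s" "s \<le> 2 * (p - wd)" using s4 wd1 by auto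
      have e: "wd * (t + 1) = p" "wd * t = p - wd"
        by (simp_all add: t_def right_diff_distrib pr)
      show "wd * (t + 1) \<le> s" "s \<le> 2 * (wd * t)"
        unfolding e by (fact le)+
    qed
    have t1: "1 \<le> t"
    proof (rule ccontr)
      assume "\<not> 1 \<le> t" then have "wd * t \<le> 0" using wd1 by (simp add: mult_le_0_iff)
      then show False using twd(2) s4 wd1 by linarith
    qed
    have tl: "l \<le> 128 * (wd * t)" using twd s4 by linarith
    have X8: "8 * int (card X) \<le> t * int d"
    proof -
      have "M * K * (1024 * w) = K * (1024 * w * M)" by (simp only: ac_simps)
      then have "card X * (1024 * w) \<le> N"
        using mult_le_mono1[OF X(2), of "1024 * w"] KN by linarith
      then have "int (card X) * (1024 * int w) \<le> int N"
        by (metis of_nat_le_iff of_nat_mult of_nat_numeral)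
      also have "\<dots> \<le> 128 * (wd * t)" using tl l by simp
      finally have "(8 * int (card X)) * (128 * int w) \<le> (t * int d) * (128 * int w)"
        by (simp add: wd_def ac_simps)
      then show ?thesis using w1 by (simp add: mult_le_cancel_right)
    qed
    \<comment> \<open>Start of a window of \<open>s\<close> integers \<open>a\<close> in the middle
      for which \<open>2 * a - m\<close> lies in an outer eighth: the right one if \<open>m\<close>
      is in the left half, the left one otherwise.\<close>
    define \<alpha> where "\<alpha> m = (if 2 * m < l then (l - l div 8 + m) div 2 + 1 else (m + 1) div 2)" for m
    define mid where "mid = {a. l \<le> 4 * a \<and> 4 * a \<le> 3 * l}"
    define out where "out = {b. 0 \<le> b \<and> b < l div 8} \<union> {b. l - l div 8 \<le> b \<and> b < l}"
    have J: "a \<in> mid" "2 * a - m \<in> out" if "0 \<le> m" "m < l" "\<alpha> m \<le> a" "a < \<alpha> m + s" for a m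
    proof -
      have "a \<in> mid \<and> 2 * a - m \<in> out"
      proof (cases "2 * m < l")
        case True
        then show ?thesis using that s4 wd1 unfolding mid_def out_def \<alpha>_def s_def
          by simp linarith
      next
        case False
        then show ?thesis using that s4 wd1 unfolding mid_def out_def \<alpha>_def s_def
          by simp linarith
      qed
      then show "a \<in> mid" "2 * a - m \<in> out" by auto
    qed
    \<comment> \<open>For fixed \<open>x\<close> this runs through a residue class modulo
      \<open>w * d\<close> of multiples of \<open>w\<close>, so points of any selected classes are
      automatically \<open>w\<close>-separated.\<close>
    define f where "f x y = int w * (int d * y + x)" for x y
    \<comment> \<open>\<open>Y m\<close> selects \<open>t\<close> consecutive periods that stay
      inside the window of \<open>m\<close> for every residue \<open>x\<close>.\<close>
    define y0 where "y0 m = \<alpha> m div wd + 1" for m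
    define Y where "Y m = {y0 m..<y0 m + t}" for m
    have f_inj: "x = x' \<and> y = y'" if "f x y = f x' y'" "x \<in> {0..<int d}" "x' \<in> {0..<int d}" for x y x' y'
    proof -
      have e: "int d * y + x = int d * y' + x'" using that(1) w1 by (simp add: f_def)
      have "x = (int d * y + x) mod int d" using that by simp
      also have "\<dots> = x'" using that by (subst e) simp
      finally have "x = x'" .
      with e show ?thesis using d1 by simp
    qed
    have fJ: "\<alpha> m \<le> f x y" "f x y < \<alpha> m + s" if "x \<in> {0..<int d}" "y \<in> Y m" for m x y
    proof -
      obtain p r where pr: "p = wd * (\<alpha> m div wd)" "r = \<alpha> m mod wd" by blast
      have "p + r = \<alpha> m" by (simp add: pr)
      moreover have "0 \<le> r" "r < wd" using wd1 by (auto simp: pr)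
      moreover have "p + wd \<le> wd * y" "wd * y \<le> p + wd * t"
        using mult_left_mono[of "\<alpha> m div wd + 1" y wd] mult_left_mono[of y "\<alpha> m div wd + t" wd] that wd1
        by (auto simp: Y_def y0_def pr distrib_left)
      moreover have "f x y = wd * y + int w * x" by (simp add: f_def wd_def algebra_simps)
      moreover have "0 \<le> int w * x" "int w * x < wd" using that w1 by (auto simp: wd_def)
      ultimately show "\<alpha> m \<le> f x y" "f x y < \<alpha> m + s"
        using twd(1) by (simp_all add: distrib_left)
    qed
    define ok where "ok m x = {y\<in>Y m. f x y \<notin> X \<and> 2 * f x y - m \<notin> X}" for m x
    define good where "good m x \<longleftrightarrow> t \<le> 2 * int (card (ok m x))" for m x
    have card_Y: "int (card (Y m)) = t" for m using t1 by (simp add: Y_def)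
    \<comment> \<open>A bad class has at least \<open>t / 2\<close> spoiled points. A spoiled
      \<open>a\<close> lies in \<open>X\<close> or is half of \<open>b + m\<close> for some
      \<open>b\<close> in \<open>X\<close>, so there are at most \<open>2 * card X\<close> of them
      altogether, and \<open>X8\<close> bounds the number of bad classes by
      \<open>d / 2\<close>.\<close>
    have goodm: "d \<le> 2 * card {x\<in>{0..<int d}. good m x}" for m
    proof -
      define Bd where "Bd x = {y\<in>Y m. f x y \<in> X \<or> 2 * f x y - m \<in> X}" for x
      define D where "D = {x\<in>{0..<int d}. \<not> good m x}"
      have finD: "finite D" unfolding D_def by (rule finite_subset[of _ "{0..<int d}"]) auto
      have finBd: "finite (Bd x)" for x
        unfolding Bd_def Y_def by (rule finite_subset[of _ "{y0 m..<y0 m + t}"]) auto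
      have big: "t \<le> 2 * int (card (Bd x))" if "x \<in> D" for x
      proof -
        have "card (Y m) = card (ok m x \<union> Bd x)"
          by (rule arg_cong[where f=card]) (auto simp: ok_def Bd_def)
        also have "\<dots> \<le> card (ok m x) + card (Bd x)" by (rule card_Un_le)
        finally show ?thesis using that card_Y[of m] unfolding D_def good_def by simp
      qed
      have inj: "inj_on (\<lambda>(x,y). f x y) (Sigma D Bd)"
      proof (rule inj_onI, clarify)
        fix x y x' y' assume "x \<in> D" "x' \<in> D" "f x y = f x' y'"
        then show "x = x' \<and> y = y'" using f_inj[of x y x' y'] by (simp add: D_def)
      qed
      have "t * int (card D) \<le> 2 * int (\<Sum>x\<in>D. card (Bd x))"
        using sum_mono[of D "\<lambda>_. t" "\<lambda>x. 2 * int (card (Bd x))"] big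
        by (simp add: sum_distrib_left mult.commute)
      also have "(\<Sum>x\<in>D. card (Bd x)) = card (Sigma D Bd)"
        using finD finBd by (intro card_SigmaI[symmetric]) auto
      also have "\<dots> = card ((\<lambda>(x,y). f x y) ` Sigma D Bd)" by (simp add: card_image[OF inj])
      also have "\<dots> \<le> card (X \<union> (\<lambda>b. (b + m) div 2) ` X)"
      proof (rule card_mono)
        show "(\<lambda>(x,y). f x y) ` Sigma D Bd \<subseteq> X \<union> (\<lambda>b. (b + m) div 2) ` X"
        proof clarsimp
          fix x y assume "x \<in> D" "y \<in> Bd x" "f x y \<notin> (\<lambda>b. (b + m) div 2) ` X"
          moreover from this have "f x y \<noteq> ((2 * f x y - m) + m) div 2 \<or> 2 * f x y - m \<notin> X" by blast
          ultimately show "f x y \<in> X" by (auto simp: Bd_def)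
        qed
      qed (use finX in auto)
      also have "\<dots> \<le> card X + card X"
        by (rule order_trans[OF card_Un_le]) (simp add: card_image_le[OF finX])
      finally have "t * int (card D) \<le> 4 * int (card X)" by simp
      then have "t * (2 * int (card D)) \<le> t * int d" using X8 by simp
      then have "2 * card D \<le> d" using t1 by (simp add: mult_le_cancel_left)
      moreover have "card {0..<int d} = card (D \<union> {x\<in>{0..<int d}. good m x})"
        by (rule arg_cong[where f=card]) (auto simp: D_def)
      moreover have "\<dots> \<le> card D + card {x\<in>{0..<int d}. good m x}" by (rule card_Un_le)
      ultimately show ?thesis by simp
    qed
    have cU: "card {0..<l} < 2 ^ n" using l by (simp add: n_def N_def nat_less_iff)
    \<comment> \<open>First greedy choice, of residue classes: by \<open>goodm\<close> the ratio is
      \<open>2\<close>, and width \<open>0\<close> imposes no separation.\<close>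
    obtain R where R: "R \<subseteq> {0..<int d}" "card R \<le> 2 * n" "\<And>m. m \<in> {0..<l} \<Longrightarrow> \<exists>x\<in>R. good m x"
      by (rule separated_cover[of "{0..<l}" "{0..<int d}" 2 n 0 good]) (use cU goodm d1 in auto)
    define A where "A = {a. a \<in> mid \<and> a \<notin> X \<and> (\<exists>x\<in>R. \<exists>y. a = f x y)}"
    have A_sub: "A \<subseteq> (\<lambda>(x,y). f x y) ` (R \<times> {0..l div int d})"
    proof
      fix a assume "a \<in> A"
      then obtain x y where a: "a \<in> mid" "x \<in> R" "a = f x y" by (auto simp: A_def)
      have al: "0 \<le> a" "a < l" using a(1) l by (auto simp: mid_def)
      have x: "0 \<le> x" "x < int d" using a(2) R(1) by auto
      have "0 \<le> y"
      proof (rule ccontr)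
        assume "\<not> 0 \<le> y" then have "int d * y \<le> int d * (-1)" by (intro mult_left_mono) auto
        then have "int d * y + x < 0" using x by simp
        then have "f x y < 0" using w1 by (simp add: f_def mult_less_0_iff)
        then show False using al a by simp
      qed
      have "int d * y \<le> 1 * (int d * y + x)" using x by simp
      also have "\<dots> \<le> int w * (int d * y + x)" using w1 x \<open>0 \<le> y\<close> by (intro mult_right_mono) auto
      also have "\<dots> < l" using al a by (simp add: f_def)
      finally have "(int d * y) div int d \<le> l div int d" using d1 by (intro zdiv_mono1) auto
      then have "y \<le> l div int d" using d1 by simp
      then show "a \<in> (\<lambda>(x,y). f x y) ` (R \<times> {0..l div int d})" using a \<open>0 \<le> y\<close> by auto
    qed
    have finR: "finite R" using R(1) finite_subset by blast
    have finA: "finite A" using A_sub finR by (meson finite_SigmaI finite_atLeastAtMost_int finite_imageI finite_subset)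
    \<comment> \<open>Each of the at most \<open>2 * n\<close> classes contributes at most
      \<open>l div d + 1\<close> points, and \<open>d = 4 * P * n\<close>.\<close>
    have cA: "int P * int (card A) \<le> int N + int P * (2 * int n)"
    proof -
      have ld0: "0 \<le> l div int d" using l d1 by (simp add: pos_imp_zdiv_nonneg_iff)
      have "card A \<le> card (R \<times> {0..l div int d})"
        using finR A_sub by (meson card_image_le card_mono finite_SigmaI finite_atLeastAtMost_int finite_imageI le_trans)
      then have "int (card A) \<le> int (card R * nat (l div int d + 1))"
        unfolding of_nat_le_iff by (simp add: card_cartesian_product)
      then have "int (card A) \<le> int (card R) * (l div int d + 1)" using ld0 by simp
      also have "\<dots> \<le> (2 * int n) * (l div int d + 1)" using R(2) ld0 by (intro mult_right_mono) auto
      finally have "int P * int (card A) \<le> int P * ((2 * int n) * (l div int d + 1))"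
        by (intro mult_left_mono) auto
      moreover have "2 * (int P * (2 * int n) * (l div int d)) \<le> 2 * int N"
      proof -
        have "2 * (int P * (2 * int n) * (l div int d)) = int d * (l div int d)"
          by (simp add: d_def c_def)
        also have "\<dots> \<le> l" using d1 by (simp flip: minus_mod_eq_mult_div)
        finally show ?thesis using l by simp
      qed
      ultimately show ?thesis by (simp add: algebra_simps)
    qed
    define G where "G m b \<longleftrightarrow> (\<exists>a\<in>A. 2 * a = m + b)" for m b
    define C where "C = out - X"
    have outl: "out \<subseteq> {0..<l}" using l by (auto simp: out_def)
    have finC: "finite C" unfolding C_def using outl finite_subset by blast
    have "card C \<le> card {0..<l}" unfolding C_def using outl by (intro card_mono) auto
    then have cC: "card C \<le> 2 * N" using l by simp
    have degm: "t \<le> 2 * int (card {b\<in>C. G m b})" if m: "m \<in> {0..<l}" for m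
    proof -
      obtain x where x: "x \<in> R" "good m x" using R(3)[OF m] by auto
      have xd: "x \<in> {0..<int d}" using x R(1) by auto
      have "card (ok m x) = card ((\<lambda>y. 2 * f x y - m) ` ok m x)"
      proof (rule card_image[symmetric], rule inj_onI)
        fix y y' assume "2 * f x y - m = 2 * f x y' - m"
        then show "y = y'" using f_inj[of x y x y'] xd by simp
      qed
      also have "\<dots> \<le> card {b\<in>C. G m b}"
      proof (rule card_mono)
        show "(\<lambda>y. 2 * f x y - m) ` ok m x \<subseteq> {b\<in>C. G m b}"
        proof clarify
          fix y assume y: "y \<in> ok m x"
          then have "f x y \<in> mid" "2 * f x y - m \<in> out"
            using J[of m "f x y"] fJ[OF xd] m by (auto simp: ok_def)
          then have "f x y \<in> A" "2 * f x y - m \<in> C" using y x by (auto simp: A_def C_def ok_def)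
          then show "2 * f x y - m \<in> C \<and> G m (2 * f x y - m)" unfolding G_def by force
        qed
      qed (use finC in simp)
      finally show ?thesis using x(2) by (simp add: good_def)
    qed
    \<comment> \<open>Input of the second greedy choice, of points \<open>b\<close>: the right side
      is at least \<open>4 * N\<close>, while \<open>card C \<le> 2 * N\<close> and the slack is at
      most \<open>N\<close>.\<close>
    have deg: "card C + q * (2 * w * q * n) \<le> q * card {b\<in>C. G m b}" if "m \<in> {0..<l}" for m
    proof -
      have "4 * int N \<le> 512 * (wd * t)" using tl l by linarith
      also have "\<dots> \<le> 512 * (wd * (2 * int (card {b\<in>C. G m b})))"
        using degm[OF that] wd1 by (intro mult_left_mono) auto
      also have "\<dots> = int q * int (card {b\<in>C. G m b})" by (simp add: q_def wd_def)
      finally have "4 * N \<le> q * card {b\<in>C. G m b}" by (metis of_nat_le_iff of_nat_mult of_nat_numeral)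
      then show ?thesis using cC fI by linarith
    qed
    have q1: "1 \<le> q" using w1 d1 by (simp add: q_def Suc_le_eq)
    have C0: "2 * w * q * n < card C"
    proof -
      have m0: "0 \<in> {0..<l}" using l by (simp add: N_def)
      have "0 < card {b\<in>C. G 0 b}" using degm[OF m0] t1 by linarith
      then have "0 < card C" using finC by (metis (no_types, lifting) card_mono le_zero_eq mem_Collect_eq not_gr_zero subsetI)
      then have "q * (2 * w * q * n) < q * card {b\<in>C. G 0 b}" using deg[OF m0] by linarith
      then have "2 * w * q * n < card {b\<in>C. G 0 b}" by simp
      also have "\<dots> \<le> card C" using finC by (intro card_mono) auto
      finally show ?thesis .
    qed
    obtain B where B: "B \<subseteq> C" "card B \<le> q * n" "\<And>m. m \<in> {0..<l} \<Longrightarrow> \<exists>c\<in>B. G m c"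
      "\<And>c c'. c \<in> B \<Longrightarrow> c' \<in> B \<Longrightarrow> c \<noteq> c' \<Longrightarrow> int w \<le> \<bar>c - c'\<bar>"
      by (rule separated_cover[OF _ finC q1 cU deg C0]) auto
    have "P * (card A + card B) \<le> 2 * N"
    proof -
      have "P * card A \<le> N + P * (2 * n)" using cA
        by (metis of_nat_add of_nat_le_iff of_nat_mult of_nat_numeral)
      moreover have "P * card B \<le> P * (q * n)" using B(2) by simp
      ultimately show ?thesis using fP unfolding distrib_left by linarith
    qed
    moreover have "P * (card A + card B) = 2 * ((1024 * w * M) * (card A + card B))" by (simp add: P_def)
    ultimately have "(1024 * w * M) * (card A + card B) \<le> N" by linarith
    then have cK: "card A + card B \<le> K" using w1 M1
      by (simp add: K_def less_eq_div_iff_mult_less_eq mult.commute)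
    have sepAB: "int w \<le> \<bar>a - b\<bar>" if "a \<in> A" "b \<in> B" for a b
    proof -
      have "a \<in> mid" "b \<in> out" using that B(1) by (auto simp: A_def C_def)
      then show ?thesis using wle wdN l wd1 unfolding mid_def out_def by simp linarith
    qed
    have sepA: "int w \<le> \<bar>a - b\<bar>" if ab: "a \<in> A" "b \<in> A" "a \<noteq> b" for a b
    proof -
      obtain i j where "a = int w * i" "b = int w * j" using ab by (auto simp: A_def f_def)
      then have "\<bar>a - b\<bar> = int w * \<bar>i - j\<bar>" "i \<noteq> j"
        using ab(3) by (auto simp: abs_mult right_diff_distrib[symmetric])
      moreover from this have "int w * 1 \<le> int w * \<bar>i - j\<bar>" by (intro mult_left_mono) auto
      ultimately show ?thesis by simp
    qed
    have "A \<inter> B = {}" using sepAB w1 by fastforce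
    moreover have "A \<subseteq> {0..<l} - X" using l by (auto simp: A_def mid_def)
    moreover have "B \<subseteq> {0..<l} - X" using B(1) outl by (auto simp: C_def)
    moreover have "\<forall>m\<in>{0..<l}. \<exists>a\<in>A. \<exists>b\<in>B. 2 * a = m + b" using B(3) by (fastforce simp: G_def)
    moreover have "\<forall>x\<in>A \<union> B. \<forall>y\<in>A \<union> B. x \<noteq> y \<longrightarrow> int w \<le> \<bar>x - y\<bar>"
      using sepA sepAB B(4) by (metis Un_iff abs_minus_commute)
    ultimately show "\<exists>A B. pair_cover w K l X A B"
      using cK unfolding pair_cover_def by blast
  qed
qed

section \<open>The group of affine maps and irreducible subshifts\<close>

text \<open>\<open>Aff b h\<close> is the map \<open>t \<mapsto> 2\<^sup>h t + b\<close>; composition is written additively, to make the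
  (noncommutative) class \<open>group_add\<close> available.\<close>

datatype aff = Aff rat int

instance aff :: countable by countable_datatype

instantiation aff :: group_add
begin

definition "0 = Aff 0 0"

fun plus_aff :: "aff \<Rightarrow> aff \<Rightarrow> aff" where
  "Aff b h + Aff r i = Aff (b + 2 powi h * r) (h + i)"

fun uminus_aff :: "aff \<Rightarrow> aff" where
  "- Aff b h = Aff (- (2 powi (- h) * b)) (- h)"

definition "p - q = p + - q" for p q :: aff

instance
proof
  fix a b c :: aff
  show "a + b + c = a + (b + c)"
    by (cases a; cases b; cases c) (simp add: power_int_add algebra_simps)
  show "0 + a = a" "a + 0 = a" by (cases a; simp add: zero_aff_def)+
  show "- a + a = 0" by (cases a) (simp add: zero_aff_def)
  show "a + - b = a - b" by (simp add: minus_aff_def)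
qed

end

definition tr :: "int \<Rightarrow> aff" where "tr n = Aff (of_int n) 0"

fun height :: "aff \<Rightarrow> nat" where "height (Aff r h) = nat \<bar>h\<bar>"

lemma tr_add: "tr (m + n) = tr m + tr n" by (simp add: tr_def)
lemma tr_0 [simp]: "tr 0 = 0" by (simp add: tr_def zero_aff_def)
lemma tr_eq_iff [simp]: "tr m = tr n \<longleftrightarrow> m = n" by (simp add: tr_def)
lemma tr_uminus: "tr (- n) = - tr n" by (simp add: tr_def)
lemma tr_diff: "tr (m - n) = tr m - tr n"
  by (metis diff_conv_add_uminus tr_add tr_uminus)
lemma inj_tr: "inj tr" by (simp add: inj_def)

text \<open>Conjugation by an element of height \<open>n\<close> multiplies or divides translations
  by \<open>2 ^ n\<close>; this and the next lemma serve to count blocked sites on neighbouring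
  cosets.\<close>

lemma tr_add_Aff_nonneg: "tr (2 ^ n * j + i) + Aff r (int n) = tr i + Aff r (int n) + tr j"
  by (simp add: tr_def algebra_simps)

lemma tr_add_Aff_nonpos: "tr i + Aff r (- int n) = Aff r (- int n) + tr (2 ^ n * i)"
  by (simp add: tr_def power_int_minus)

text \<open>Zorn's lemma, used both for a maximal set of cuts and for a maximal family of compatible
  blocks.\<close>

lemma maximal_clique:
  assumes Q0: "Q0 \<subseteq> \<Omega>" "\<And>a b. a \<in> Q0 \<Longrightarrow> b \<in> Q0 \<Longrightarrow> a \<noteq> b \<Longrightarrow> R a b"
    and sym: "\<And>a b. R a b \<Longrightarrow> R b a"
  obtains Q where "Q0 \<subseteq> Q" "Q \<subseteq> \<Omega>" "\<forall>a\<in>Q. \<forall>b\<in>Q. a \<noteq> b \<longrightarrow> R a b"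
    "\<forall>a\<in>\<Omega>. (\<forall>b\<in>Q. R a b) \<longrightarrow> a \<in> Q"
proof -
  define F where "F = {Q. Q0 \<subseteq> Q \<and> Q \<subseteq> \<Omega> \<and> (\<forall>a\<in>Q. \<forall>b\<in>Q. a \<noteq> b \<longrightarrow> R a b)}"
  have "\<exists>M\<in>F. \<forall>X\<in>F. M \<subseteq> X \<longrightarrow> X = M"
  proof (rule subset_Zorn_nonempty)
    show "F \<noteq> {}" using Q0 by (auto simp: F_def)
    fix C assume C: "C \<noteq> {}" "subset.chain F C"
    then have CF: "C \<subseteq> F" and ch: "\<And>x y. x \<in> C \<Longrightarrow> y \<in> C \<Longrightarrow> x \<subseteq> y \<or> y \<subseteq> x"
      by (auto simp: subset_chain_def)
    have "R a b" if "a \<in> x" "x \<in> C" "b \<in> y" "y \<in> C" "a \<noteq> b" for a b x y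
      using ch[of x y] that CF by (auto simp: F_def subset_iff)
    then show "\<Union>C \<in> F" using CF C(1) by (auto simp: F_def subset_iff; blast)
  qed
  then obtain M where M: "M \<in> F" "\<And>X. X \<in> F \<Longrightarrow> M \<subseteq> X \<Longrightarrow> X = M" by blast
  show ?thesis
  proof (rule that[of M])
    show "\<forall>a\<in>\<Omega>. (\<forall>b\<in>M. R a b) \<longrightarrow> a \<in> M"
    proof (intro ballI impI)
      fix a assume a: "a \<in> \<Omega>" "\<forall>b\<in>M. R a b"
      then have "insert a M \<in> F" using M(1) sym by (auto simp: F_def)
      then show "a \<in> M" using M(2)[of "insert a M"] by auto
    qed
  qed (use M(1) in \<open>auto simp: F_def\<close>)
qed

section \<open>Configurations on the affine group and irreducibility\<close>

type_synonym config = "aff \<Rightarrow> bool"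

text \<open>Translation on the left reverses the order of composition:
  \<open>shift h (shift g x) = shift (g + h) x\<close>.\<close>

definition shift :: "aff \<Rightarrow> config \<Rightarrow> config" where "shift g x = (\<lambda>p. x (g + p))"

definition shift_invariant :: "config set \<Rightarrow> bool" where
  "shift_invariant S \<longleftrightarrow> (\<forall>x\<in>S. \<forall>g. shift g x \<in> S)"

text \<open>A pair \<open>(p, x) \<in> R\<close> asks for the value of \<open>x\<close> at \<open>p\<close>, and \<open>D\<close>-close sites must ask for values of the
  same configuration. With arbitrarily many prescribed configurations instead of two, the sets \<open>S\<close>
  need not be closed.\<close>

definition irreducible_shift :: "aff set \<Rightarrow> config set \<Rightarrow> bool" where
  "irreducible_shift D S \<longleftrightarrow> finite D \<and> 0 \<in> D \<and> (\<forall>d\<in>D. - d \<in> D) \<and>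
    (\<forall>R. (\<forall>p x. (p, x) \<in> R \<longrightarrow> x \<in> S) \<and>
       (\<forall>p x q y. (p, x) \<in> R \<longrightarrow> (q, y) \<in> R \<longrightarrow> - p + q \<in> D \<longrightarrow> x = y) \<longrightarrow>
       (\<exists>z\<in>S. \<forall>p x. (p, x) \<in> R \<longrightarrow> z p = x p))"

section \<open>Tilings of the cosets by blocks\<close>

text \<open>The block \<open>(c, l, A, B)\<close> occupies the sites \<open>c + tr i\<close> for \<open>0 \<le> i < l\<close>; the first pattern is placed at
  \<open>i \<in> A\<close>, the second one at \<open>i \<in> B\<close>.\<close>

type_synonym block = "aff \<times> int \<times> int set \<times> int set"

fun cells :: "block \<Rightarrow> aff set" where "cells (c, l, A, B) = (\<lambda>i. c + tr i) ` {0..<l}"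
fun uspots :: "block \<Rightarrow> aff set" where "uspots (c, l, A, B) = (\<lambda>i. c + tr i) ` A"
fun vspots :: "block \<Rightarrow> aff set" where "vspots (c, l, A, B) = (\<lambda>i. c + tr i) ` B"

definition spots :: "block \<Rightarrow> aff set" where "spots b = uspots b \<union> vspots b"

text \<open>\<open>E\<close> stands for the differences of sites at which two pattern copies may
  interact; its symmetry makes \<open>compatible\<close> symmetric.\<close>

locale block_params =
  fixes L K :: nat and E :: "aff set"
  assumes L0: "0 < L" and E_sym: "e \<in> E \<Longrightarrow> - e \<in> E"
begin

fun good_block :: "block \<Rightarrow> bool" where
  "good_block (c, l, A, B) \<longleftrightarrow> int L \<le> l \<and> l < 2 * int L \<and> A \<subseteq> {0..<l} \<and> B \<subseteq> {0..<l} \<and> A \<inter> B = {} \<and>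
     card A + card B \<le> K \<and> (\<forall>m\<in>{0..<l}. \<exists>a\<in>A. \<exists>b\<in>B. 2 * a = m + b) \<and>
     (\<forall>i\<in>A \<union> B. \<forall>j\<in>A \<union> B. i \<noteq> j \<longrightarrow> tr (j - i) \<notin> E)"

definition compatible :: "block \<Rightarrow> block \<Rightarrow> bool" where
  "compatible b b' \<longleftrightarrow> cells b \<inter> cells b' = {} \<and> (\<forall>p\<in>spots b. \<forall>q\<in>spots b'. - p + q \<notin> E)"

definition tiling :: "block set \<Rightarrow> bool" where
  "tiling Q \<longleftrightarrow> (\<forall>b\<in>Q. good_block b) \<and> (\<forall>b\<in>Q. \<forall>b'\<in>Q. b \<noteq> b' \<longrightarrow> compatible b b') \<and>
     (\<forall>p. \<exists>b\<in>Q. p \<in> cells b)"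

lemma compatible_sym: "compatible b b' \<Longrightarrow> compatible b' b"
proof -
  have "- q + p = - (- p + q)" for p q :: aff by (simp add: minus_add)
  then show "compatible b b' \<Longrightarrow> compatible b' b"
    unfolding compatible_def using E_sym by (metis inf_commute minus_minus)
qed

lemma spots_subset_cells: "good_block b \<Longrightarrow> spots b \<subseteq> cells b"
  by (cases b) (auto simp: spots_def)

lemma uspots_vspots_disjoint: "good_block b \<Longrightarrow> uspots b \<inter> vspots b = {}"
  by (cases b) auto

lemma card_spots_le: "good_block b \<Longrightarrow> finite (spots b) \<and> card (spots b) \<le> K"
proof (cases b)
  case (fields c l A B)
  assume g: "good_block b"
  then have fin: "finite A" "finite B" using fields finite_subset by auto
  have "card (spots b) \<le> card (uspots b) + card (vspots b)" unfolding spots_def by (rule card_Un_le)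
  also have "\<dots> \<le> card A + card B" using fields fin by (auto intro!: add_mono card_image_le)
  finally show ?thesis using g fields fin by (auto simp: spots_def)
qed

lemma spots_separated:
  assumes "good_block b" "p \<in> spots b" "q \<in> spots b" "- p + q \<in> E"
  shows "p = q"
proof (cases b)
  case (fields c l A B)
  then obtain i j where ij: "i \<in> A \<union> B" "j \<in> A \<union> B" "p = c + tr i" "q = c + tr j"
    using assms by (auto simp: spots_def)
  have "- p + q = tr (j - i)" unfolding ij minus_add
    by (metis add.assoc add.commute add_diff_cancel_left' diff_conv_add_uminus left_minus add_0_left tr_add tr_uminus)
  then show ?thesis using assms fields ij by auto
qed

lemma tiling_unique:
  "tiling Q \<Longrightarrow> b \<in> Q \<Longrightarrow> b' \<in> Q \<Longrightarrow> p \<in> cells b \<Longrightarrow> p \<in> cells b' \<Longrightarrow> b = b'"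
  unfolding tiling_def compatible_def by blast

text \<open>A block has at least \<open>L\<close> cells, so one that meets a window of
  \<open>L\<close> sites contains the first or the last site of the window. By disjointness there
  are at most two such blocks.\<close>

lemma window_spots:
  assumes Q: "\<And>b. b \<in> Q \<Longrightarrow> good_block b"
    "\<And>b b'. b \<in> Q \<Longrightarrow> b' \<in> Q \<Longrightarrow> b \<noteq> b' \<Longrightarrow> cells b \<inter> cells b' = {}"
  shows "card {j\<in>{0..<int L}. p + tr j \<in> \<Union>(spots ` Q)} \<le> 2 * K"
proof -
  define J where "J r = {j. \<exists>b\<in>Q. r \<in> cells b \<and> p + tr j \<in> spots b}" for r
  have Jc: "finite (J r) \<and> card (J r) \<le> K" for r
  proof (cases "\<exists>b\<in>Q. r \<in> cells b")
    case True
    then obtain b where b: "b \<in> Q" "r \<in> cells b" by blast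
    have uniq: "b' = b" if "b' \<in> Q" "r \<in> cells b'" for b' using Q(2)[of b' b] b that by blast
    have "J r = (\<lambda>j. p + tr j) -` spots b" using b by (auto simp: J_def dest: uniq)
    moreover have inj: "inj (\<lambda>j. p + tr j)" by (simp add: inj_def)
    moreover have f: "finite (spots b)" "card (spots b) \<le> K" using card_spots_le[OF Q(1)[OF b(1)]] by auto
    moreover have "card ((\<lambda>j. p + tr j) -` spots b) \<le> card (spots b)"
      using inj f by (intro card_inj_on_le[of "\<lambda>j. p + tr j"]) (auto intro: inj_on_subset)
    ultimately show ?thesis by (simp add: finite_vimageI)
  next
    case False then show ?thesis by (auto simp: J_def)
  qed
  have "{j\<in>{0..<int L}. p + tr j \<in> \<Union>(spots ` Q)} \<subseteq> J p \<union> J (p + tr (int L - 1))"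
  proof clarify
    fix j b assume j: "j \<in> {0..<int L}" "p + tr j \<in> spots b" "j \<notin> J (p + tr (int L - 1))" and b: "b \<in> Q"
    obtain c l A B where bb: "b = (c, l, A, B)" by (cases b)
    have "p + tr j \<in> cells b" using j b Q(1) spots_subset_cells by blast
    then obtain i where i: "p + tr j = c + tr i" "0 \<le> i" "i < l" using bb by auto
    have l: "int L \<le> l" using Q(1)[OF b] bb by simp
    have pc: "p = c + tr (i - j)" using i(1) by (metis add.right_neutral add_diff_eq diff_add_cancel tr_diff)
    have "p + tr (int L - 1) = c + tr (i - j + (int L - 1))" unfolding pc tr_add add.assoc ..
    moreover have "p + tr (int L - 1) \<notin> cells b" using j b by (auto simp: J_def)
    ultimately have "\<not> (i - j + (int L - 1) < l)" using bb i(2) j(1) by auto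
    then have "p \<in> cells b" using pc bb i j(1) l by auto
    then show "j \<in> J p" using b j by (auto simp: J_def)
  qed
  then have "card {j\<in>{0..<int L}. p + tr j \<in> \<Union>(spots ` Q)} \<le> card (J p \<union> J (p + tr (int L - 1)))"
    using Jc by (intro card_mono) auto
  also have "\<dots> \<le> K + K" using Jc by (intro order_trans[OF card_Un_le] add_mono) auto
  finally show ?thesis by simp
qed

lemma long_window_spots:
  assumes Q: "\<And>b. b \<in> Q \<Longrightarrow> good_block b"
    "\<And>b b'. b \<in> Q \<Longrightarrow> b' \<in> Q \<Longrightarrow> b \<noteq> b' \<Longrightarrow> cells b \<inter> cells b' = {}"
  shows "card {j\<in>{0..<int N * int L}. p + tr j \<in> \<Union>(spots ` Q)} \<le> N * (2 * K)"
proof (induction N)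
  case 0 show ?case by simp
next
  case (Suc N)
  let ?W = "\<lambda>N. {j\<in>{0..<int N * int L}. p + tr j \<in> \<Union>(spots ` Q)}"
  let ?p = "p + tr (int N * int L)"
  have fin: "finite (?W N)" "finite {j\<in>{0..<int L}. ?p + tr j \<in> \<Union>(spots ` Q)}"
    by (rule finite_subset[OF Collect_restrict finite_atLeastLessThan_int])+
  have "?W (Suc N) \<subseteq> ?W N \<union> (\<lambda>j. j + int N * int L) ` {j\<in>{0..<int L}. ?p + tr j \<in> \<Union>(spots ` Q)}"
  proof
    fix j assume j: "j \<in> ?W (Suc N)"
    show "j \<in> ?W N \<union> (\<lambda>j. j + int N * int L) ` {j\<in>{0..<int L}. ?p + tr j \<in> \<Union>(spots ` Q)}"
    proof (cases "j < int N * int L")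
      case True then show ?thesis using j by auto
    next
      case False
      have "?p + tr (j - int N * int L) = p + tr j" by (simp add: add.assoc flip: tr_add)
      then show ?thesis using j False
        by (intro UnI2 image_eqI[of _ _ "j - int N * int L"]) (auto simp: algebra_simps)
    qed
  qed
  then have "card (?W (Suc N)) \<le> card (?W N \<union> (\<lambda>j. j + int N * int L) ` {j\<in>{0..<int L}. ?p + tr j \<in> \<Union>(spots ` Q)})"
    using fin by (intro card_mono finite_UnI finite_imageI)
  also have "\<dots> \<le> N * (2 * K) + 2 * K"
    by (intro order_trans[OF card_Un_le] add_mono Suc order_trans[OF card_image_le[OF fin(2)]] window_spots Q)
  finally show ?case by simp
qed

text \<open>Conjugation by \<open>e\<close> maps \<open>\<langle>tr 1\<rangle>\<close> to a commensurable subgroup, so the sites \<open>c + tr i + e\<close> meet only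
  boundedly many blocks.\<close>

lemma blocked_by_translate:
  assumes Q: "\<And>b. b \<in> Q \<Longrightarrow> good_block b"
    "\<And>b b'. b \<in> Q \<Longrightarrow> b' \<in> Q \<Longrightarrow> b \<noteq> b' \<Longrightarrow> cells b \<inter> cells b' = {}"
  shows "card {i\<in>{0..<2 * int L}. c + tr i + e \<in> \<Union>(spots ` Q)} \<le> 4 * 2 ^ height e * K"
proof (cases e)
  case (Aff r h)
  let ?n = "nat \<bar>h\<bar>" and ?S = "\<Union>(spots ` Q)"
  show ?thesis
  proof (cases "0 \<le> h")
    case True
    then have e: "e = Aff r (int ?n)" using Aff by simp
    let ?W = "\<lambda>i'. {j\<in>{0..<int 2 * int L}. (c + tr i' + e) + tr j \<in> ?S}"
    have fin: "finite (?W i')" for i' by (rule finite_subset[of _ "{0..<int 2 * int L}"]) auto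
    \<comment> \<open>For \<open>i\<close> in a fixed residue class modulo \<open>2 ^ ?n\<close> the
      sites \<open>c + tr i + e\<close> are consecutive on one coset.\<close>
    have "{i\<in>{0..<2 * int L}. c + tr i + e \<in> ?S} \<subseteq> (\<Union>i'\<in>{0..<2 ^ ?n}. (\<lambda>j. 2 ^ ?n * j + i') ` ?W i')"
    proof
      fix i assume i: "i \<in> {i\<in>{0..<2 * int L}. c + tr i + e \<in> ?S}"
      define j i' where "j = i div 2 ^ ?n" and "i' = i mod 2 ^ ?n"
      have ij: "i = 2 ^ ?n * j + i'" by (simp add: j_def i'_def)
      have "tr i + e = tr i' + e + tr j"
        using tr_add_Aff_nonneg[of ?n j i' r] ij e by simp
      then have "c + tr i + e = (c + tr i' + e) + tr j" by (simp add: add.assoc)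
      moreover have "i' \<in> {0..<2 ^ ?n}" by (simp add: i'_def)
      moreover have "0 \<le> j" using i by (simp add: j_def pos_imp_zdiv_nonneg_iff)
      moreover have "j \<le> i" using i zdiv_mono2[of i 1 "2 ^ ?n"] by (simp add: j_def)
      ultimately show "i \<in> (\<Union>i'\<in>{0..<2 ^ ?n}. (\<lambda>j. 2 ^ ?n * j + i') ` ?W i')"
        using i ij by (intro UN_I[of i'] image_eqI[of _ _ j]) auto
    qed
    then have "card {i\<in>{0..<2 * int L}. c + tr i + e \<in> ?S} \<le> card (\<Union>i'\<in>{0..<2 ^ ?n}. (\<lambda>j. 2 ^ ?n * j + i') ` ?W i')"
      using fin by (intro card_mono) auto
    also have "\<dots> \<le> (\<Sum>i'\<in>{0..<2 ^ ?n::int}. card ((\<lambda>j. 2 ^ ?n * j + i') ` ?W i'))"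
      by (rule card_UN_le) auto
    also have "\<dots> \<le> (\<Sum>i'\<in>{0..<2 ^ ?n::int}. 2 * (2 * K))"
      by (intro sum_mono order_trans[OF card_image_le[OF fin]] long_window_spots Q)
    finally show ?thesis using Aff by (simp add: nat_power_eq)
  next
    case False
    then have e: "e = Aff r (- int ?n)" using Aff by simp
    let ?W = "{j\<in>{0..<int (2 ^ Suc ?n) * int L}. (c + e) + tr j \<in> ?S}"
    \<comment> \<open>Now all the sites lie on the coset of \<open>c + e\<close>, spread out by the
      factor \<open>2 ^ ?n\<close>, so one longer window contains them.\<close>
    have "(\<lambda>i. 2 ^ ?n * i) ` {i\<in>{0..<2 * int L}. c + tr i + e \<in> ?S} \<subseteq> ?W"
    proof clarify
      fix i b assume i: "i \<in> {0..<2 * int L}" "b \<in> Q" "c + tr i + e \<in> spots b"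
      have "tr i + e = e + tr (2 ^ ?n * i)" using tr_add_Aff_nonpos[of i r ?n] e by simp
      then have "c + tr i + e = (c + e) + tr (2 ^ ?n * i)" by (simp add: add.assoc)
      then show "2 ^ ?n * i \<in> {0..<int (2 ^ Suc ?n) * int L} \<and> (c + e) + tr (2 ^ ?n * i) \<in> ?S"
        using i by auto
    qed
    then have "card ((\<lambda>i. 2 ^ ?n * i) ` {i\<in>{0..<2 * int L}. c + tr i + e \<in> ?S}) \<le> card ?W"
      by (intro card_mono finite_subset[of ?W "{0..<int (2 ^ Suc ?n) * int L}"]) auto
    also have "\<dots> \<le> 2 ^ Suc ?n * (2 * K)" by (intro long_window_spots Q)
    finally show ?thesis using Aff by (subst (asm) card_image) (auto simp: inj_on_def)
  qed
qed

section \<open>Cuts between blocks and the extension of partial tilings\<close>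

definition cuts :: "block set \<Rightarrow> aff set" where
  "cuts Q = {p. \<exists>c l A B. (c, l, A, B) \<in> Q \<and> (p = c \<or> p = c + tr l)}"

definition sparse_cuts :: "aff set \<Rightarrow> bool" where
  "sparse_cuts C \<longleftrightarrow> (\<forall>p\<in>C. \<forall>n. p + tr n \<in> C \<and> \<bar>n\<bar> < int L \<longrightarrow> n = 0)"

text \<open>A maximal clique for the relation of not being on one coset at distance less than
  \<open>L\<close>. A site with no cut nearby could be added to it.\<close>

lemma maximal_cuts:
  assumes C0: "sparse_cuts C0"
  obtains C where "C0 \<subseteq> C" "sparse_cuts C" "\<And>p. \<exists>n. \<bar>n\<bar> < int L \<and> p + tr n \<in> C"
proof -
  define R where "R p q \<longleftrightarrow> (\<forall>n. q = p + tr n \<longrightarrow> int L \<le> \<bar>n\<bar>)" for p q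
  have symR: "R b a" if "R a b" for a b
    unfolding R_def
  proof (intro allI impI)
    fix n assume "a = b + tr n"
    then have "b = a + tr (- n)" by (simp add: tr_uminus add.assoc)
    then show "int L \<le> \<bar>n\<bar>" using that unfolding R_def by fastforce
  qed
  have RC0: "R a b" if ab: "a \<in> C0" "b \<in> C0" "a \<noteq> b" for a b
    unfolding R_def
  proof (intro allI impI, rule ccontr)
    fix n assume n: "b = a + tr n" "\<not> int L \<le> \<bar>n\<bar>"
    then have "n = 0" using C0 ab unfolding sparse_cuts_def by auto
    then show False using n ab by simp
  qed
  obtain C where C: "C0 \<subseteq> C" "C \<subseteq> UNIV" "\<forall>a\<in>C. \<forall>b\<in>C. a \<noteq> b \<longrightarrow> R a b"
    "\<forall>a\<in>UNIV. (\<forall>b\<in>C. R a b) \<longrightarrow> a \<in> C"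
    by (rule maximal_clique[of C0 UNIV R, OF subset_UNIV RC0 symR])
  show ?thesis
  proof (rule that[of C])
    show "sparse_cuts C" unfolding sparse_cuts_def
    proof (intro ballI allI impI, rule ccontr)
      fix p n assume p: "p \<in> C" "p + tr n \<in> C \<and> \<bar>n\<bar> < int L" "n \<noteq> 0"
      then have "p \<noteq> p + tr n" by (metis add.right_neutral add_left_cancel tr_0 tr_eq_iff)
      then have "R p (p + tr n)" using C(3) p by blast
      then show False using p(2) unfolding R_def by fastforce
    qed
    fix p
    show "\<exists>n. \<bar>n\<bar> < int L \<and> p + tr n \<in> C"
    proof (cases "p \<in> C")
      case True then show ?thesis using L0 by (intro exI[of _ 0]) auto
    next
      case False
      then obtain b where "b \<in> C" "\<not> R p b" using C(4) by blast
      then show ?thesis unfolding R_def by (auto simp: not_le)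
    qed
  qed (use C in auto)
qed

text \<open>A cut at distance less than \<open>L\<close> from \<open>c + tr (int L)\<close> lies
  strictly between \<open>c\<close> and \<open>c + tr (2 * int L)\<close>, and sparsity keeps it
  \<open>L\<close> away from \<open>c\<close>. The left side is symmetric.\<close>

lemma cut_gap:
  assumes C: "sparse_cuts C" and near: "\<And>p. \<exists>n. \<bar>n\<bar> < int L \<and> p + tr n \<in> C" and c: "c \<in> C"
  shows "\<exists>l. int L \<le> l \<and> l < 2 * int L \<and> c + tr l \<in> C"
    and "\<exists>l. int L \<le> l \<and> l < 2 * int L \<and> c - tr l \<in> C"
proof -
  obtain n where n: "\<bar>n\<bar> < int L" "c + tr (int L) + tr n \<in> C" using near by blast
  have "c + tr (int L + n) \<in> C" using n by (simp add: tr_add add.assoc)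
  moreover from this have "\<not> \<bar>int L + n\<bar> < int L" using C c n L0 unfolding sparse_cuts_def by fastforce
  ultimately show "\<exists>l. int L \<le> l \<and> l < 2 * int L \<and> c + tr l \<in> C"
    using n(1) by (intro exI[of _ "int L + n"]) auto
  obtain n where n: "\<bar>n\<bar> < int L" "c + tr (- int L) + tr n \<in> C" using near by blast
  have "c + tr (- (int L - n)) \<in> C" using n by (simp add: add.assoc flip: tr_add)
  moreover from this have "\<not> \<bar>- (int L - n)\<bar> < int L" using C c n L0 unfolding sparse_cuts_def by fastforce
  ultimately show "\<exists>l. int L \<le> l \<and> l < 2 * int L \<and> c - tr l \<in> C"
    using n(1) unfolding tr_uminus by (intro exI[of _ "int L - n"]) auto
qed

text \<open>A cut strictly inside would leave two gaps of length at least \<open>L\<close>, against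
  \<open>l < 2 * int L\<close>.\<close>

lemma cut_gap_unique:
  assumes "sparse_cuts C" "c + tr l \<in> C" "c + tr i \<in> C" "0 \<le> i" "i < l" "l < 2 * int L" "c \<in> C"
  shows "i = 0"
proof (rule ccontr)
  assume i0: "i \<noteq> 0"
  then have "int L \<le> i" using assms unfolding sparse_cuts_def by fastforce
  moreover have "c + tr l = (c + tr i) + tr (l - i)" by (simp add: add.assoc flip: tr_add)
  ultimately have "l - i = 0"
    using assms(1)[unfolded sparse_cuts_def, rule_format, of "c + tr i" "l - i"] assms by auto
  then show False using assms by simp
qed

text \<open>A maximal set of cuts does not cut the given blocks, since these are shorter than \<open>2 L\<close>.\<close>

lemma extend_to_tiling:
  assumes finE: "finite E" and M: "(\<Sum>e\<in>E. 4 * 2 ^ height e) \<le> M"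
    and w: "\<And>n. tr n \<in> E \<Longrightarrow> \<bar>n\<bar> < int w"
    and place: "\<And>l X. int L \<le> l \<Longrightarrow> l < 2 * int L \<Longrightarrow> X \<subseteq> {0..<l} \<Longrightarrow> card X \<le> M * K \<Longrightarrow>
      \<exists>A B. pair_cover w K l X A B"
    and Q0: "\<And>b. b \<in> Q0 \<Longrightarrow> good_block b"
      "\<And>b b'. b \<in> Q0 \<Longrightarrow> b' \<in> Q0 \<Longrightarrow> b \<noteq> b' \<Longrightarrow> compatible b b'" "sparse_cuts (cuts Q0)"
  obtains Q where "tiling Q" "Q0 \<subseteq> Q"
proof -
  obtain C where C: "cuts Q0 \<subseteq> C" "sparse_cuts C" and near: "\<And>p. \<exists>n. \<bar>n\<bar> < int L \<and> p + tr n \<in> C"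
    using maximal_cuts[OF Q0(3)] by blast
  \<comment> \<open>Only blocks that begin and end at cuts are candidates; \<open>Q\<close> is a
    maximal compatible family of them containing \<open>Q0\<close>.\<close>
  define \<Omega> where "\<Omega> = {(c, l, A, B). c \<in> C \<and> c + tr l \<in> C \<and> good_block (c, l, A, B)}"
  have "Q0 \<subseteq> \<Omega>" using Q0(1) C(1) by (fastforce simp: \<Omega>_def cuts_def)
  then obtain Q where Q12: "Q0 \<subseteq> Q" "Q \<subseteq> \<Omega>"
    and Q34: "\<forall>b\<in>Q. \<forall>b'\<in>Q. b \<noteq> b' \<longrightarrow> compatible b b'" "\<forall>b\<in>\<Omega>. (\<forall>b'\<in>Q. compatible b b') \<longrightarrow> b \<in> Q"
    by (rule maximal_clique[of Q0 \<Omega> compatible, OF _ Q0(2) compatible_sym])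
  note Q = Q12 Q34[rule_format]
  have good: "good_block b" if "b \<in> Q" for b using that Q(2) by (auto simp: \<Omega>_def)
  have disj: "cells b \<inter> cells b' = {}" if "b \<in> Q" "b' \<in> Q" "b \<noteq> b'" for b b'
    using Q(3)[OF that] by (simp add: compatible_def)
  \<comment> \<open>A gap without a block could be filled by avoiding the positions blocked by
    \<open>Q\<close>, contradicting maximality.\<close>
  have full: "\<exists>A B. (c, l, A, B) \<in> Q" if c: "c \<in> C" and l: "int L \<le> l" "l < 2 * int L" "c + tr l \<in> C" for c l
  proof (rule ccontr)
    assume no: "\<nexists>A B. (c, l, A, B) \<in> Q"
    \<comment> \<open>Positions at which a spot would interact with a spot of \<open>Q\<close>; for
      each \<open>e\<close> they are counted by \<open>blocked_by_translate\<close>.\<close>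
    define X where "X = {i\<in>{0..<l}. \<exists>e\<in>E. c + tr i + e \<in> \<Union>(spots ` Q)}"
    have fin: "finite {i\<in>{0..<2 * int L}. c + tr i + e \<in> \<Union>(spots ` Q)}" for e
      by (rule finite_subset[OF Collect_restrict finite_atLeastLessThan_int])
    have "card X \<le> card (\<Union>e\<in>E. {i\<in>{0..<2 * int L}. c + tr i + e \<in> \<Union>(spots ` Q)})"
      using fin finE l(2) by (intro card_mono finite_UN_I) (auto simp: X_def)
    also have "\<dots> \<le> (\<Sum>e\<in>E. card {i\<in>{0..<2 * int L}. c + tr i + e \<in> \<Union>(spots ` Q)})"
      by (rule card_UN_le[OF finE])
    also have "\<dots> \<le> (\<Sum>e\<in>E. 4 * 2 ^ height e * K)"
      by (intro sum_mono blocked_by_translate good disj)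
    also have "\<dots> \<le> M * K" using M by (simp flip: sum_distrib_right)
    finally have cX: "card X \<le> M * K" .
    have "X \<subseteq> {0..<l}" by (auto simp: X_def)
    from place[OF l(1,2) this cX] obtain A B where "pair_cover w K l X A B" by blast
    then have AB: "A \<subseteq> {0..<l} - X" "B \<subseteq> {0..<l} - X" "A \<inter> B = {}" "card A + card B \<le> K"
        "\<forall>m\<in>{0..<l}. \<exists>a\<in>A. \<exists>b\<in>B. 2 * a = m + b"
        "\<forall>x\<in>A \<union> B. \<forall>y\<in>A \<union> B. x \<noteq> y \<longrightarrow> int w \<le> \<bar>x - y\<bar>"
      unfolding pair_cover_def by simp_all
    define b where "b = (c, l, A, B)"
    have "tr (j - i) \<notin> E" if "i \<in> A \<union> B" "j \<in> A \<union> B" "i \<noteq> j" for i j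
      using AB(6) that w[of "j - i"] by (metis abs_minus_commute not_less)
    then have gb: "good_block b" using AB l by (auto simp: b_def)
    have "compatible b b'" if b': "b' \<in> Q" for b'
    proof -
      obtain c' l' A' B' where bb': "b' = (c', l', A', B')" by (cases b')
      have \<Omega>': "c' \<in> C" "c' + tr l' \<in> C" "good_block b'" using b' Q(2) bb' by (auto simp: \<Omega>_def)
      have "cells b \<inter> cells b' = {}"
      proof (rule ccontr)
        assume "cells b \<inter> cells b' \<noteq> {}"
        then obtain i j where ij: "c + tr i = c' + tr j" "0 \<le> i" "i < l" "0 \<le> j" "j < l'"
          by (fastforce simp: b_def bb')
        have cc: "c' = c + tr (i - j)" using ij(1) by (metis add.right_neutral add_diff_eq diff_add_cancel tr_diff)
        then have cc': "c = c' + tr (j - i)" by (simp add: add.assoc flip: tr_add)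
        \<comment> \<open>Both blocks are shorter than \<open>2 * L\<close> and end at cuts, so
          overlapping ones start at the same cut, and then they have equal length.\<close>
        have "i = j"
        proof (cases "j \<le> i")
          case True
          then show ?thesis using cut_gap_unique[of C c l "i - j"] C l c \<Omega>' cc ij by auto
        next
          case False
          then show ?thesis using cut_gap_unique[of C c' l' "j - i"] C c \<Omega>' cc' ij bb' by auto
        qed
        then have "c' = c" using cc by simp
        moreover from this have "l' = l"
          using cut_gap_unique[of C c l l'] cut_gap_unique[of C c l' l] C l c \<Omega>' bb' L0
          by (cases l l' rule: linorder_cases) auto
        ultimately show False using no b' bb' by blast
      qed
      moreover have "- p + q \<notin> E" if p: "p \<in> spots b" and q: "q \<in> spots b'" for p q
      proof
        assume e: "- p + q \<in> E"
        obtain i where i: "i \<in> A \<union> B" "p = c + tr i" using p by (auto simp: b_def spots_def)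
        have "c + tr i + (- p + q) = q" by (simp add: i(2) flip: add.assoc)
        then have "i \<in> X" using i(1) AB(1,2) e q b' by (fastforce simp: X_def)
        then show False using i(1) AB(1,2) by auto
      qed
      ultimately show ?thesis by (auto simp: compatible_def)
    qed
    then have "b \<in> Q" using Q(4)[of b] gb c l by (auto simp: \<Omega>_def b_def)
    then show False using no by (auto simp: b_def)
  qed
  have "\<exists>b\<in>Q. p \<in> cells b" for p
  proof -
    have "\<exists>c l i. c \<in> C \<and> int L \<le> l \<and> l < 2 * int L \<and> c + tr l \<in> C \<and> 0 \<le> i \<and> i < l \<and> p = c + tr i"
    proof -
      obtain n where n: "\<bar>n\<bar> < int L" "p + tr n \<in> C" using near by blast
      show ?thesis
      proof (cases "n \<le> 0")
        case True
        obtain l where "int L \<le> l" "l < 2 * int L" "p + tr n + tr l \<in> C" using cut_gap(1)[OF C(2) near n(2)] by blast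
        moreover have "p = p + tr n + tr (- n)" by (simp add: add.assoc flip: tr_add)
        ultimately show ?thesis using n True by (intro exI[of _ "p + tr n"] exI[of _ l] exI[of _ "- n"]) auto
      next
        case False
        obtain l where l: "int L \<le> l" "l < 2 * int L" "p + tr n - tr l \<in> C" using cut_gap(2)[OF C(2) near n(2)] by blast
        have "tr n - tr l + tr (l - n) = 0" by (simp flip: tr_diff tr_add)
        then have "p = p + tr n - tr l + tr (l - n)" by (metis add.assoc add.right_neutral add_diff_eq)
        moreover have "p + tr n - tr l + tr l \<in> C" using n by simp
        ultimately show ?thesis using n False l by (intro exI[of _ "p + tr n - tr l"] exI[of _ l] exI[of _ "l - n"]) auto
      qed
    qed
    then obtain c l i where cl: "c \<in> C" "int L \<le> l" "l < 2 * int L" "c + tr l \<in> C" "0 \<le> i" "i < l" "p = c + tr i" by blast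
    then obtain A B where "(c, l, A, B) \<in> Q" using full by blast
    then show ?thesis using cl by force
  qed
  then have "tiling Q" using good Q(3) by (auto simp: tiling_def)
  then show ?thesis using Q(1) that by blast
qed

text \<open>The block containing \<open>c + tr l\<close> must start there, as otherwise it would
  also contain the last cell \<open>c + tr (l - 1)\<close> of the given block. So all cuts are
  starting points, and those are \<open>L\<close> apart because blocks are that long.\<close>

lemma tiling_cuts:
  assumes T: "tiling Q"
  shows "cuts Q = fst ` Q" "sparse_cuts (cuts Q)"
proof -
  have start: "c + tr l \<in> fst ` Q" if b: "(c, l, A, B) \<in> Q" for c l A B
  proof -
    have l: "int L \<le> l" using T b by (auto simp: tiling_def)
    obtain c' l' A' B' where b': "(c', l', A', B') \<in> Q" "c + tr l \<in> cells (c', l', A', B')"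
      using T unfolding tiling_def by (metis prod_cases4)
    then obtain i where i: "c + tr l = c' + tr i" "0 \<le> i" "i < l'" by auto
    have "i = 0"
    proof (rule ccontr)
      assume "i \<noteq> 0"
      have "c + tr (l - 1) = c' + tr (i - 1)" using i(1) by (simp add: tr_diff add_diff_eq)
      then have "c + tr (l - 1) \<in> cells (c', l', A', B')" using i \<open>i \<noteq> 0\<close> by auto
      moreover have "c + tr (l - 1) \<in> cells (c, l, A, B)" using l L0 by auto
      ultimately have "c = c' \<and> l = l'" using tiling_unique[OF T b b'(1)] by auto
      then show False using i by simp
    qed
    then have "c + tr l = c'" using i by simp
    then show ?thesis using b' by force
  qed
  show e: "cuts Q = fst ` Q" using start by (force simp: cuts_def)
  show "sparse_cuts (cuts Q)" unfolding e sparse_cuts_def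
  proof (intro ballI allI impI)
    fix p n assume p: "p \<in> fst ` Q" "p + tr n \<in> fst ` Q \<and> \<bar>n\<bar> < int L"
    obtain l A B l' A' B' where b: "(p, l, A, B) \<in> Q" "(p + tr n, l', A', B') \<in> Q" using p by fastforce
    have l: "int L \<le> l" "int L \<le> l'" using T b by (auto simp: tiling_def)
    have "p = p + tr n + tr (- n)" by (simp add: add.assoc flip: tr_add)
    then have "p \<in> cells (p + tr n, l', A', B') \<or> p + tr n \<in> cells (p, l, A, B)"
      using l p by (cases "0 \<le> n") auto
    moreover have "p \<in> cells (p, l, A, B)" "p + tr n \<in> cells (p + tr n, l', A', B')"
      using l L0 by (auto intro!: image_eqI[of _ _ 0])
    ultimately have "p = p + tr n" using tiling_unique[OF T b] by blast
    then show "n = 0" by (metis add.right_neutral add_left_cancel tr_0 tr_eq_iff)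
  qed
qed

end

text \<open>Normal form of words in a noncommutative group.\<close>

lemmas group_normal = diff_conv_add_uminus minus_add minus_minus add.assoc add_minus_cancel
  minus_add_cancel left_minus right_minus add_0_left add_0_right

section \<open>Refining an irreducible subshift\<close>

text \<open>The two patterns are \<open>xu\<close> and \<open>xv\<close> restricted to
  \<open>F\<close>. If \<open>p + f\<close> and \<open>q + f'\<close> are \<open>D\<close>-close,
  then \<open>- p + q\<close> has the form \<open>f + d - f'\<close>; this is where \<open>E\<close>
  comes from.\<close>

locale refinement = block_params +
  fixes S :: "config set" and D F :: "aff set" and xu xv :: config and M w :: nat
  assumes inv: "shift_invariant S" and irr: "irreducible_shift D S"
    and finF: "finite F" and xuS: "xu \<in> S" and xvS: "xv \<in> S"
    and E_eq: "E = {f + d - f' | f d f'. f \<in> F \<and> d \<in> D \<and> f' \<in> F}"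
    and M: "(\<Sum>e\<in>E. 4 * 2 ^ height e) \<le> M" and w: "\<And>n. tr n \<in> E \<Longrightarrow> \<bar>n\<bar> < int w"
    and place: "\<And>l X. int L \<le> l \<Longrightarrow> l < 2 * int L \<Longrightarrow> X \<subseteq> {0..<l} \<Longrightarrow> card X \<le> M * K \<Longrightarrow>
      \<exists>A B. pair_cover w K l X A B"
begin

definition carries :: "config \<Rightarrow> block set \<Rightarrow> bool" where
  "carries x Q \<longleftrightarrow> (\<forall>b\<in>Q. (\<forall>p\<in>uspots b. \<forall>f\<in>F. x (p + f) = xu f) \<and> (\<forall>p\<in>vspots b. \<forall>f\<in>F. x (p + f) = xv f))"

definition refined :: "config set" where
  "refined = {x\<in>S. \<exists>Q. tiling Q \<and> carries x Q}"

text \<open>Offsets from a prescribed site to the spots whose pattern copy comes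
  \<open>D\<close>-close to it.\<close>

definition near :: "aff set" where "near = {d - f | d f. d \<in> D \<and> f \<in> F}"

text \<open>Kept blocks with cells at such a difference must stem from the same configuration.
  \<open>E\<close> accounts for interacting spots, the translations for common cells and for cuts
  fewer than \<open>L\<close> sites apart, where a cut may lie one site past its block.\<close>

definition close :: "aff set" where "close = E \<union> tr ` {- int L - 1..int L + 1}"

text \<open>The new interaction set: a path from a prescribed site to a nearby cell, along its
  block, by a \<open>close\<close> step into another block, and back to another prescribed
  site.\<close>

definition gap :: "aff set" where
  "gap = D \<union> (\<Union>g\<in>near. \<Union>g'\<in>near. \<Union>e\<in>close. \<Union>i\<in>{- 2 * int L..2 * int L}. \<Union>j\<in>{- 2 * int L..2 * int L}.
     {g + tr i + e - tr j - g'})"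

lemma D_props: "finite D" "0 \<in> D" "\<And>d. d \<in> D \<Longrightarrow> - d \<in> D"
  using irr by (auto simp: irreducible_shift_def)

lemma finE: "finite E"
proof -
  have "E = (\<lambda>(f, d, f'). f + d - f') ` (F \<times> D \<times> F)" unfolding E_eq by force
  then show ?thesis using finF D_props by simp
qed

lemma fin_near: "finite near"
proof -
  have "near = (\<lambda>(d, f). d - f) ` (D \<times> F)" unfolding near_def by force
  then show ?thesis using finF D_props by simp
qed

lemma fin_gap: "finite gap"
  unfolding gap_def close_def using finE fin_near D_props by auto

lemma close_uminus: "e \<in> close \<Longrightarrow> - e \<in> close"
  unfolding close_def
proof (elim UnE imageE)
  fix n assume "e = tr n" "n \<in> {- int L - 1..int L + 1}"
  then show "- e \<in> E \<union> tr ` {- int L - 1..int L + 1}"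
    by (intro UnI2 image_eqI[of _ _ "- n"]) (auto simp: tr_uminus)
qed (use E_sym in auto)

lemma gap_uminus: "d \<in> gap \<Longrightarrow> - d \<in> gap"
  unfolding gap_def
proof (elim UnE UN_E)
  fix g g' e i j
  assume d: "g \<in> near" "g' \<in> near" "e \<in> close" "i \<in> {- 2 * int L..2 * int L}" "j \<in> {- 2 * int L..2 * int L}"
    "d \<in> {g + tr i + e - tr j - g'}"
  have "- d = g' + tr j + (- e) - tr i - g"
    using d(6) unfolding singleton_iff by (simp only: group_normal)
  then show "- d \<in> D \<union> (\<Union>g\<in>near. \<Union>g'\<in>near. \<Union>e\<in>close. \<Union>i\<in>{- 2 * int L..2 * int L}. \<Union>j\<in>{- 2 * int L..2 * int L}.
     {g + tr i + e - tr j - g'})"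
    using d close_uminus[OF d(3)] by blast
qed (use D_props in auto)

text \<open>The tiling is carried along by \<open>- g\<close>; left translation respects the cosets
  and the differences \<open>- p + q\<close>.\<close>

lemma refined_invariant: "shift_invariant refined"
  unfolding shift_invariant_def
proof (intro ballI allI)
  fix x g assume "x \<in> refined"
  then obtain Q where x: "x \<in> S" "tiling Q" "carries x Q" by (auto simp: refined_def)
  define mv :: "block \<Rightarrow> block" where "mv b = (- g + fst b, snd b)" for b
  have img: "(\<lambda>i. - g + c + tr i) ` A = (\<lambda>p. - g + p) ` (\<lambda>i. c + tr i) ` A" for c A
    by (simp add: image_image add.assoc)
  have mv_cells: "cells (mv b) = (\<lambda>p. - g + p) ` cells b" for b
    by (cases b) (simp add: mv_def img)
  have mv_u: "uspots (mv b) = (\<lambda>p. - g + p) ` uspots b" for b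
    by (cases b) (simp add: mv_def img)
  have mv_v: "vspots (mv b) = (\<lambda>p. - g + p) ` vspots b" for b
    by (cases b) (simp add: mv_def img)
  have mv_spots: "spots (mv b) = (\<lambda>p. - g + p) ` spots b" for b
    by (simp add: spots_def mv_u mv_v image_Un)
  have mv_good: "good_block (mv b) = good_block b" for b
    by (cases b) (simp add: mv_def)
  have cancel: "- (- g + p) + (- g + q) = - p + q" for p q :: aff
    by (simp only: group_normal)
  have mv_comp: "compatible b b' \<Longrightarrow> compatible (mv b) (mv b')" for b b'
    unfolding compatible_def mv_cells mv_spots by (auto simp: cancel)
  have "tiling (mv ` Q)"
    unfolding tiling_def
  proof (intro conjI allI)
    show "\<forall>b\<in>mv ` Q. good_block b" using x(2) by (auto simp: tiling_def mv_good)
    show "\<forall>b\<in>mv ` Q. \<forall>b'\<in>mv ` Q. b \<noteq> b' \<longrightarrow> compatible b b'"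
    proof (intro ballI impI, elim imageE)
      fix c c' b b' assume "c \<noteq> c'" "c = mv b" "b \<in> Q" "c' = mv b'" "b' \<in> Q"
      then show "compatible c c'" using x(2) mv_comp[of b b'] by (metis tiling_def)
    qed
    fix p
    obtain b where "b \<in> Q" "g + p \<in> cells b" using x(2) unfolding tiling_def by blast
    then show "\<exists>b\<in>mv ` Q. p \<in> cells b"
      by (intro bexI[of _ "mv b"]) (auto simp: mv_cells intro!: image_eqI[of _ _ "g + p"])
  qed
  moreover have "carries (shift g x) (mv ` Q)"
    using x(3) by (auto simp: carries_def mv_u mv_v shift_def add.assoc[symmetric])
  moreover have "shift g x \<in> S" using inv x(1) by (simp add: shift_invariant_def)
  ultimately show "shift g x \<in> refined" by (auto simp: refined_def)
qed

lemma refined_solves: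
  assumes "x \<in> refined"
  shows "\<exists>n. \<bar>n\<bar> \<le> 2 * int L \<and> (\<forall>f\<in>F. x (tr n + f) = xu f) \<and> (\<forall>f\<in>F. x (tr (2 * n) + f) = xv f)"
proof -
  obtain Q where Q: "tiling Q" "carries x Q" using assms by (auto simp: refined_def)
  then obtain c l A B where b: "(c, l, A, B) \<in> Q" "0 \<in> cells (c, l, A, B)"
    unfolding tiling_def by (metis prod_cases4)
  then obtain m where m: "0 = c + tr m" "m \<in> {0..<l}" by auto
  have g: "good_block (c, l, A, B)" using Q(1) b(1) unfolding tiling_def by blast
  then have "\<forall>m\<in>{0..<l}. \<exists>a\<in>A. \<exists>b\<in>B. 2 * a = m + b" by simp
  then obtain a a' where a: "a \<in> A" "a' \<in> B" "2 * a = m + a'" using m(2) by blast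
  have c: "c = tr (- m)" using m(1) by (metis add.inverse_unique minus_minus neg_eq_iff_add_eq_0 tr_uminus)
  have "c + tr a = tr (a - m)" "c + tr a' = tr (2 * (a - m))"
    unfolding c using a(3) by (simp_all flip: tr_add add: algebra_simps)
  then have "tr (a - m) \<in> uspots (c, l, A, B)" "tr (2 * (a - m)) \<in> vspots (c, l, A, B)"
    using a by (force)+
  then have "(\<forall>f\<in>F. x (tr (a - m) + f) = xu f) \<and> (\<forall>f\<in>F. x (tr (2 * (a - m)) + f) = xv f)"
    using Q(2) b(1) unfolding carries_def by blast
  moreover have "a \<in> {0..<l}" "l < 2 * int L" using g a(1) by auto
  then have "\<bar>a - m\<bar> \<le> 2 * int L" using m(2) by auto
  ultimately show ?thesis by blast
qed

text \<open>From the tiling of each prescribed configuration the blocks near the prescribed sites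
  are kept. They are compatible by the choice of \<open>gap\<close> and extend to a tiling
  \<open>Q\<close>. Irreducibility of \<open>S\<close> is then applied to the given prescriptions
  together with all pattern copies demanded by \<open>Q\<close>.\<close>

lemma refined_irreducible: "irreducible_shift gap refined"
  unfolding irreducible_shift_def
proof (intro conjI allI impI)
  fix R :: "(aff \<times> config) set"
  assume H: "(\<forall>p x. (p, x) \<in> R \<longrightarrow> x \<in> refined) \<and>
    (\<forall>p x q y. (p, x) \<in> R \<longrightarrow> (q, y) \<in> R \<longrightarrow> - p + q \<in> gap \<longrightarrow> x = y)"
  then have RS: "\<And>p x. (p, x) \<in> R \<Longrightarrow> x \<in> refined" by blast
  have RD: "x = y" if "(p, x) \<in> R" "(q, y) \<in> R" "- p + q \<in> gap" for p x q y using H that by blast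
  \<comment> \<open>One tiling is fixed per configuration, so that prescriptions from the same
    \<open>x\<close> keep mutually compatible blocks.\<close>
  define tq where "tq x = (SOME Q. tiling Q \<and> carries x Q)" for x
  have tq: "tiling (tq x)" "carries x (tq x)" if "x \<in> refined" for x
  proof -
    have "\<exists>Q. tiling Q \<and> carries x Q" using that by (simp add: refined_def)
    then have "tiling (tq x) \<and> carries x (tq x)" unfolding tq_def by (rule someI_ex)
    then show "tiling (tq x)" "carries x (tq x)" by blast+
  qed
  define kept where "kept b x \<longleftrightarrow> (\<exists>p g. (p, x) \<in> R \<and> g \<in> near \<and> b \<in> tq x \<and> p + g \<in> cells b)" for b x
  define Q0 where "Q0 = {b. \<exists>x. kept b x}"
  have keptD: "x \<in> refined" "b \<in> tq x" "good_block b" if "kept b x" for b x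
  proof -
    show 1: "x \<in> refined" using that RS unfolding kept_def by blast
    show 2: "b \<in> tq x" using that unfolding kept_def by blast
    show "good_block b" using tq(1)[OF 1] 2 unfolding tiling_def by blast
  qed
  have src: "x = y"
    if "(p, x) \<in> R" "(q, y) \<in> R" "g \<in> near" "g' \<in> near" "\<bar>i\<bar> \<le> 2 * int L" "\<bar>j\<bar> \<le> 2 * int L"
      "- (p + g + tr i) + (q + g' + tr j) \<in> close" for p x q y g g' i j
  proof -
    let ?e = "- (p + g + tr i) + (q + g' + tr j)"
    have "- p + q = g + tr i + ?e - tr j - g'"
      by (simp only: group_normal)
    moreover have "i \<in> {- 2 * int L..2 * int L}" "j \<in> {- 2 * int L..2 * int L}" using that(5,6) by auto
    ultimately have "- p + q \<in> gap" unfolding gap_def using that(3,4,7) by blast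
    then show ?thesis using RD that by blast
  qed
  have cell_shift: "\<exists>i. \<bar>i\<bar> \<le> 2 * int L \<and> q = p + tr i" if b: "good_block b" "p \<in> cells b" "q \<in> cells b" for b p q
  proof (cases b)
    case (fields c l A B)
    then obtain i j where "p = c + tr i" "q = c + tr j" "i \<in> {0..<l}" "j \<in> {0..<l}" using b by auto
    moreover have "c + tr j = c + tr i + tr (j - i)" by (simp add: add.assoc flip: tr_add)
    ultimately show ?thesis using b(1) fields by (intro exI[of _ "j - i"]) auto
  qed
  \<comment> \<open>Moving along both blocks back to the prescribed sites that caused them to be
    kept reduces this to \<open>src\<close>.\<close>
  have same: "x = y" if k: "kept b x" "kept b' y" and q: "q \<in> cells b" "q' \<in> cells b'" "- q + q' \<in> close" for b b' x y q q'
  proof -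
    obtain p g where p: "(p, x) \<in> R" "g \<in> near" "p + g \<in> cells b" using k by (auto simp: kept_def)
    obtain p' g' where p': "(p', y) \<in> R" "g' \<in> near" "p' + g' \<in> cells b'" using k by (auto simp: kept_def)
    obtain i where i: "\<bar>i\<bar> \<le> 2 * int L" "q = p + g + tr i" using cell_shift keptD(3)[OF k(1)] p(3) q(1) by blast
    obtain j where j: "\<bar>j\<bar> \<le> 2 * int L" "q' = p' + g' + tr j" using cell_shift keptD(3)[OF k(2)] p'(3) q(2) by blast
    show ?thesis using src[OF p(1) p'(1) p(2) p'(2) i(1) j(1)] q(3) i j by simp
  qed
  have E_close: "E \<subseteq> close" by (auto simp: close_def)
  have tr_close: "tr n \<in> close" if "\<bar>n\<bar> \<le> int L + 1" for n
    unfolding close_def using that by (intro UnI2 imageI) auto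
  have Q0_good: "good_block b" if "b \<in> Q0" for b using that keptD(3) unfolding Q0_def by blast
  have Q0_comp: "compatible b b'" if bb: "b \<in> Q0" "b' \<in> Q0" "b \<noteq> b'" for b b'
  proof -
    obtain x y where k: "kept b x" "kept b' y" using bb unfolding Q0_def by blast
    have c: "compatible b b'" if "x = y"
      using tq(1)[OF keptD(1)[OF k(1)]] keptD(2)[OF k(1)] keptD(2)[OF k(2)] that bb(3)
      unfolding tiling_def by blast
    show ?thesis
    proof (rule ccontr)
      assume n: "\<not> compatible b b'"
      then consider p where "p \<in> cells b" "p \<in> cells b'" | p q where "p \<in> spots b" "q \<in> spots b'" "- p + q \<in> E"
        unfolding compatible_def by blast
      then have "x = y"
      proof cases
        case 1 then show ?thesis using same[OF k 1] tr_close[of 0] by simp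
      next
        case 2 then show ?thesis
          using same[OF k, of p q] spots_subset_cells[OF Q0_good[OF bb(1)]]
            spots_subset_cells[OF Q0_good[OF bb(2)]] E_close by blast
      qed
      then show False using n c by blast
    qed
  qed
  have "sparse_cuts (cuts Q0)"
    unfolding sparse_cuts_def
  proof (intro ballI allI impI)
    fix p n assume p: "p \<in> cuts Q0" "p + tr n \<in> cuts Q0 \<and> \<bar>n\<bar> < int L"
    \<comment> \<open>The shift \<open>i\<close> is \<open>0\<close> at the start of a block and
      \<open>1\<close> at its end, where the cut is just past the last cell.\<close>
    have cutD: "\<exists>b x i. kept b x \<and> r \<in> cuts (tq x) \<and> i \<in> {0, 1} \<and> r - tr i \<in> cells b" if r: "r \<in> cuts Q0" for r
    proof -
      obtain c l A B where b: "(c, l, A, B) \<in> Q0" "r = c \<or> r = c + tr l" using r by (auto simp: cuts_def)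
      obtain x where x: "kept (c, l, A, B) x" using b by (auto simp: Q0_def)
      have "int L \<le> l" using keptD(3)[OF x] by simp
      then have "\<exists>i\<in>{0, 1}. r - tr i \<in> cells (c, l, A, B)"
        using b(2) L0 by (auto simp: add_diff_eq[symmetric] simp flip: tr_diff intro: image_eqI[of _ _ 0])
      moreover have "r \<in> cuts (tq x)" using keptD(2)[OF x] b(2) by (auto simp: cuts_def)
      ultimately show ?thesis using x by blast
    qed
    obtain b x i where b: "kept b x" "p \<in> cuts (tq x)" "i \<in> {0, 1}" "p - tr i \<in> cells b" using cutD[OF p(1)] by blast
    obtain b' y j where b': "kept b' y" "p + tr n \<in> cuts (tq y)" "j \<in> {0, 1}" "p + tr n - tr j \<in> cells b'" using cutD p(2) by blast
    have "- (p - tr i) + (p + tr n - tr j) = tr (i + n - j)"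
      by (simp only: tr_uminus tr_add group_normal)
    moreover have "\<bar>i + n - j\<bar> \<le> int L + 1" using b(3) b'(3) p(2) by auto
    ultimately have "x = y" using same[OF b(1) b'(1) b(4) b'(4)] tr_close by simp
    then show "n = 0" using tiling_cuts(2)[OF tq(1)[OF keptD(1)[OF b(1)]]] b(2) b'(2) p(2)
      unfolding sparse_cuts_def by blast
  qed
  then obtain Q where Q: "tiling Q" "Q0 \<subseteq> Q"
    using extend_to_tiling[OF finE M w place Q0_good Q0_comp] by blast
  \<comment> \<open>Blocks outside \<open>Q0\<close> take their patterns from translates of
    \<open>xu\<close> and \<open>xv\<close>. Kept blocks instead use the configuration that already
    carries the pattern there, which cannot contradict its own prescriptions.\<close>
  define new where "new q f y \<longleftrightarrow> (\<exists>b\<in>Q - Q0. f \<in> F \<and> (q \<in> uspots b \<and> y = shift (- q) xu \<or> q \<in> vspots b \<and> y = shift (- q) xv))" for q f y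
  define old where "old q f y \<longleftrightarrow> (\<exists>b. kept b y \<and> f \<in> F \<and> q \<in> spots b)" for q f y
  define R' where "R' = R \<union> {(q + f, y) | q f y. old q f y} \<union> {(q + f, y) | q f y. new q f y}"
  have EI: "- q + q' \<in> E" if "- (q + f) + (q' + f') \<in> D" "f \<in> F" "f' \<in> F" for q q' f f'
  proof -
    have "- q + q' = f + (- (q + f) + (q' + f')) - f'"
      by (simp only: group_normal)
    then show ?thesis unfolding E_eq using that by blast
  qed
  have nearI: "\<exists>g\<in>near. q = p + g" if "- p + (q + f) \<in> D" "f \<in> F" for p q f
  proof -
    have "q = p + ((- p + (q + f)) - f)" by (simp only: group_normal)
    moreover have "(- p + (q + f)) - f \<in> near" unfolding near_def using that by blast
    ultimately show ?thesis by blast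
  qed
  have RR: "x = y" if "(p, x) \<in> R" "(q, y) \<in> R" "- p + q \<in> D" for p x q y
    using RD that by (auto simp: gap_def)
  have Ro: "x = y" if R: "(p, x) \<in> R" and o: "old q f y" and d: "- p + (q + f) \<in> D" for p x q f y
  proof -
    obtain b where b: "kept b y" "f \<in> F" "q \<in> spots b" using o by (auto simp: old_def)
    obtain g where g: "g \<in> near" "q = p + g" using nearI d b(2) by blast
    obtain p' g' where p': "(p', y) \<in> R" "g' \<in> near" "p' + g' \<in> cells b" using b by (auto simp: kept_def)
    have "q \<in> cells b" using b keptD(3) spots_subset_cells by blast
    then obtain j where j: "\<bar>j\<bar> \<le> 2 * int L" "q = p' + g' + tr j" using cell_shift keptD(3)[OF b(1)] p'(3) by blast
    show ?thesis using src[OF R p'(1) g(1) p'(2), of 0 j] j g tr_close[of 0] by auto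
  qed
  \<comment> \<open>The block through \<open>q\<close> in the tiling of \<open>x\<close> was kept,
    so a spot of a new block cannot be there.\<close>
  have Rn: False if R: "(p, x) \<in> R" and n: "new q f y" and d: "- p + (q + f) \<in> D" for p x q f y
  proof -
    obtain b where b: "b \<in> Q - Q0" "f \<in> F" "q \<in> spots b" using n by (auto simp: new_def spots_def)
    obtain g where g: "g \<in> near" "q = p + g" using nearI d b(2) by blast
    obtain b' where b': "b' \<in> tq x" "q \<in> cells b'" using tq(1)[OF RS[OF R]] unfolding tiling_def by blast
    then have "b' \<in> Q0" using R g by (auto simp: Q0_def kept_def)
    moreover have "good_block b" using b(1) Q(1) unfolding tiling_def by blast
    then have "q \<in> cells b" using b(3) spots_subset_cells by blast
    ultimately show False using tiling_unique[OF Q(1), of b b' q] b b' Q(2) by blast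
  qed
  have oo: "x = y" if o: "old q f x" "old q' f' y" and d: "- (q + f) + (q' + f') \<in> D" for q f x q' f' y
  proof -
    obtain b where b: "kept b x" "f \<in> F" "q \<in> spots b" using o by (auto simp: old_def)
    obtain b' where b': "kept b' y" "f' \<in> F" "q' \<in> spots b'" using o by (auto simp: old_def)
    have "q \<in> cells b" "q' \<in> cells b'"
      using spots_subset_cells[OF keptD(3)[OF b(1)]] spots_subset_cells[OF keptD(3)[OF b'(1)]] b(3) b'(3) by blast+
    then show ?thesis using same[OF b(1) b'(1)] EI[OF d b(2) b'(2)] E_close by blast
  qed
  have on: False if o: "old q f x" and n: "new q' f' y" and d: "- (q + f) + (q' + f') \<in> D" for q f x q' f' y
  proof -
    obtain b where b: "kept b x" "f \<in> F" "q \<in> spots b" using o by (auto simp: old_def)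
    obtain b' where b': "b' \<in> Q - Q0" "f' \<in> F" "q' \<in> spots b'" using n by (auto simp: new_def spots_def)
    have "b \<in> Q0" using b by (auto simp: Q0_def)
    then have "b \<in> Q" "b' \<in> Q" "b \<noteq> b'" using Q(2) b'(1) by blast+
    then have "compatible b b'" using Q(1) unfolding tiling_def by blast
    then show False using EI[OF d b(2) b'(2)] b(3) b'(3) unfolding compatible_def by blast
  qed
  \<comment> \<open>Interacting new spots lie in one block and hence coincide; within a block the
    two kinds of spots are disjoint.\<close>
  have nn: "x = y" if n: "new q f x" "new q' f' y" and d: "- (q + f) + (q' + f') \<in> D" for q f x q' f' y
  proof -
    obtain b where b: "b \<in> Q" "f \<in> F" "q \<in> uspots b \<and> x = shift (- q) xu \<or> q \<in> vspots b \<and> x = shift (- q) xv"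
      using n by (auto simp: new_def)
    obtain b' where b': "b' \<in> Q" "f' \<in> F" "q' \<in> uspots b' \<and> y = shift (- q') xu \<or> q' \<in> vspots b' \<and> y = shift (- q') xv"
      using n by (auto simp: new_def)
    have sp: "q \<in> spots b" "q' \<in> spots b'" using b b' by (auto simp: spots_def)
    have e: "- q + q' \<in> E" by (rule EI[OF d b(2) b'(2)])
    have "b = b'" using Q(1) b(1) b'(1) sp e unfolding tiling_def compatible_def by blast
    moreover have gb: "good_block b" using Q(1) b(1) unfolding tiling_def by blast
    ultimately have "q = q'" using spots_separated[OF gb sp(1) _ e] sp(2) by simp
    then show ?thesis using b(3) b'(3) uspots_vspots_disjoint[OF gb] \<open>b = b'\<close> by auto
  qed
  have Dsym: "- q + p \<in> D" if "- p + q \<in> D" for p q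
    using D_props(3)[OF that] by (simp add: minus_add)
  have R'S: "\<forall>p x. (p, x) \<in> R' \<longrightarrow> x \<in> S"
  proof -
    have "x \<in> S" if "(p, x) \<in> R" for p x using RS[OF that] by (simp add: refined_def)
    moreover have "x \<in> S" if "old q f x" for q f x
      using that keptD(1) by (auto simp: old_def refined_def)
    moreover have "x \<in> S" if "new q f x" for q f x
      using that inv xuS xvS by (auto simp: new_def shift_invariant_def)
    ultimately show ?thesis unfolding R'_def by blast
  qed
  have R'D: "\<forall>p x q y. (p, x) \<in> R' \<longrightarrow> (q, y) \<in> R' \<longrightarrow> - p + q \<in> D \<longrightarrow> x = y"
  proof (intro allI impI)
    fix p x q y assume 1: "(p, x) \<in> R'" "(q, y) \<in> R'" "- p + q \<in> D"
    have 2: "- q + p \<in> D" by (rule Dsym[OF 1(3)])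
    from 1(1) consider "(p, x) \<in> R" | a f where "p = a + f" "old a f x" | a f where "p = a + f" "new a f x"
      by (auto simp: R'_def)
    then show "x = y"
    proof cases
      case p: 1
      from 1(2) consider "(q, y) \<in> R" | a f where "q = a + f" "old a f y" | a f where "q = a + f" "new a f y"
        by (auto simp: R'_def)
      then show ?thesis
      proof cases
        case q: 1 then show ?thesis using RR[OF p q] 1(3) by simp
      next
        case q: 2 then show ?thesis using Ro[OF p q(2)] 1(3) by simp
      next
        case q: 3 then show ?thesis using Rn[OF p q(2)] 1(3) by simp
      qed
    next
      case p: 2
      from 1(2) consider "(q, y) \<in> R" | a f where "q = a + f" "old a f y" | a f where "q = a + f" "new a f y"
        by (auto simp: R'_def)
      then show ?thesis
      proof cases
        case q: 1 then show ?thesis using Ro[OF q p(2)] 2 p(1) by simp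
      next
        case q: 2 then show ?thesis using oo[OF p(2) q(2)] 1(3) p(1) by simp
      next
        case q: 3 then show ?thesis using on[OF p(2) q(2)] 1(3) p(1) by simp
      qed
    next
      case p: 3
      from 1(2) consider "(q, y) \<in> R" | a f where "q = a + f" "old a f y" | a f where "q = a + f" "new a f y"
        by (auto simp: R'_def)
      then show ?thesis
      proof cases
        case q: 1 then show ?thesis using Rn[OF q p(2)] 2 p(1) by simp
      next
        case q: 2 then show ?thesis using on[OF q(2) p(2)] 2 p(1) by simp
      next
        case q: 3 then show ?thesis using nn[OF p(2) q(2)] 1(3) p(1) by simp
      qed
    qed
  qed
  obtain z where z: "z \<in> S" "\<And>p x. (p, x) \<in> R' \<Longrightarrow> z p = x p"
    using irr R'S R'D unfolding irreducible_shift_def by blast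
  have "carries z Q" unfolding carries_def
  proof (intro ballI conjI)
    fix b p f assume b: "b \<in> Q" "p \<in> uspots b" "f \<in> F"
    show "z (p + f) = xu f"
    proof (cases "b \<in> Q0")
      case True
      then obtain x where x: "kept b x" by (auto simp: Q0_def)
      then have "old p f x" using b unfolding old_def spots_def by blast
      then have "(p + f, x) \<in> R'" unfolding R'_def by blast
      then have "z (p + f) = x (p + f)" by (rule z)
      also have "\<dots> = xu f" using tq(2)[OF keptD(1)[OF x]] keptD(2)[OF x] b by (simp add: carries_def)
      finally show ?thesis .
    next
      case False
      then have "new p f (shift (- p) xu)" using b unfolding new_def by blast
      then have "(p + f, shift (- p) xu) \<in> R'" unfolding R'_def by blast
      then have "z (p + f) = shift (- p) xu (p + f)" by (rule z)
      then show ?thesis by (simp add: shift_def add.assoc[symmetric])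
    qed
  next
    fix b p f assume b: "b \<in> Q" "p \<in> vspots b" "f \<in> F"
    show "z (p + f) = xv f"
    proof (cases "b \<in> Q0")
      case True
      then obtain x where x: "kept b x" by (auto simp: Q0_def)
      then have "old p f x" using b unfolding old_def spots_def by blast
      then have "(p + f, x) \<in> R'" unfolding R'_def by blast
      then have "z (p + f) = x (p + f)" by (rule z)
      also have "\<dots> = xv f" using tq(2)[OF keptD(1)[OF x]] keptD(2)[OF x] b by (simp add: carries_def)
      finally show ?thesis .
    next
      case False
      then have "new p f (shift (- p) xv)" using b unfolding new_def by blast
      then have "(p + f, shift (- p) xv) \<in> R'" unfolding R'_def by blast
      then have "z (p + f) = shift (- p) xv (p + f)" by (rule z)
      then show ?thesis by (simp add: shift_def add.assoc[symmetric])
    qed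
  qed
  then have "z \<in> refined" using z(1) Q(1) by (auto simp: refined_def)
  moreover have "\<forall>p x. (p, x) \<in> R \<longrightarrow> z p = x p" using z(2) by (auto simp: R'_def)
  ultimately show "\<exists>z\<in>refined. \<forall>p x. (p, x) \<in> R \<longrightarrow> z p = x p" by blast
next
  show "finite gap" by (rule fin_gap)
  show "0 \<in> gap" using D_props by (simp add: gap_def)
  show "\<forall>d\<in>gap. - d \<in> gap" using gap_uminus by blast
qed

end

section \<open>Admissible subshifts and a single refinement step\<close>

definition admissible :: "config set \<Rightarrow> bool" where
  "admissible S \<longleftrightarrow> S \<noteq> {} \<and> shift_invariant S \<and> (\<exists>D. irreducible_shift D S)"

lemma admissible_UNIV: "admissible UNIV"
proof -
  have "\<exists>z. \<forall>p x. (p, x) \<in> R \<longrightarrow> z p = x p"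
    if R: "\<forall>p x q y. (p, x) \<in> R \<longrightarrow> (q, y) \<in> R \<longrightarrow> - p + q \<in> {0} \<longrightarrow> x = y" for R :: "(aff \<times> config) set"
  proof (intro exI[of _ "\<lambda>p. (SOME x. (p, x) \<in> R) p"] allI impI)
    fix p x assume px: "(p, x) \<in> R"
    then have "(p, SOME x. (p, x) \<in> R) \<in> R" by (rule someI[of "\<lambda>x. (p, x) \<in> R"])
    then have "(SOME x. (p, x) \<in> R) = x" using R px by auto
    then show "(SOME x. (p, x) \<in> R) p = x p" by simp
  qed
  then have "irreducible_shift {0} UNIV" unfolding irreducible_shift_def by simp
  then show ?thesis unfolding admissible_def shift_invariant_def by blast
qed

text \<open>The order of the constants matters: \<open>D\<close> and \<open>F\<close> determine
  \<open>E\<close>, which gives \<open>w\<close> and \<open>M\<close>, and only these enter the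
  choice of \<open>L\<close> and \<open>K\<close> by \<open>sparse_pair_cover\<close>.\<close>

lemma refine_admissible:
  assumes S: "admissible S" and F: "finite F" and xu: "xu \<in> S" and xv: "xv \<in> S"
  obtains S' N where "S' \<subseteq> S" "admissible S'"
    "\<And>x. x \<in> S' \<Longrightarrow> \<exists>n. \<bar>n\<bar> \<le> N \<and> (\<forall>f\<in>F. x (tr n + f) = xu f) \<and> (\<forall>f\<in>F. x (tr (2 * n) + f) = xv f)"
proof -
  obtain D where D: "irreducible_shift D S" using S unfolding admissible_def by blast
  then have D0: "finite D" "0 \<in> D" "\<And>d. d \<in> D \<Longrightarrow> - d \<in> D" by (auto simp: irreducible_shift_def)
  define E where "E = {f + d - f' | f d f'. f \<in> F \<and> d \<in> D \<and> f' \<in> F}"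
  have "E = (\<lambda>(f, d, f'). f + d - f') ` (F \<times> D \<times> F)" unfolding E_def by force
  then have finE: "finite E" using F D0 by simp
  have "finite (tr -` E)" using finE inj_tr by (rule finite_vimageI)
  then have fin: "finite ((\<lambda>n. nat \<bar>n\<bar>) ` (tr -` E))" by simp
  define w where "w = Suc (Max (insert 0 ((\<lambda>n. nat \<bar>n\<bar>) ` (tr -` E))))"
  define M where "M = Suc (\<Sum>e\<in>E. 4 * 2 ^ height e)"
  have w: "\<bar>n\<bar> < int w" if "tr n \<in> E" for n
  proof -
    have "nat \<bar>n\<bar> \<le> Max (insert 0 ((\<lambda>n. nat \<bar>n\<bar>) ` (tr -` E)))" using fin that by (intro Max_ge) auto
    then show ?thesis by (simp add: w_def)
  qed
  have wM: "1 \<le> w" "1 \<le> M" by (auto simp: w_def M_def)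
  obtain L K :: nat where L: "0 < L"
    and place: "\<And>l X. int L \<le> l \<Longrightarrow> l < 2 * int L \<Longrightarrow> X \<subseteq> {0..<l} \<Longrightarrow> card X \<le> M * K \<Longrightarrow>
      \<exists>A B. pair_cover w K l X A B"
    by (rule sparse_pair_cover[OF wM]) blast
  have Esym: "- e \<in> E" if e: "e \<in> E" for e
  proof -
    obtain f d f' where fd: "e = f + d - f'" "f \<in> F" "d \<in> D" "f' \<in> F" using e unfolding E_def by blast
    have "- e = f' + (- d) - f" unfolding fd(1) by (simp only: group_normal)
    then show ?thesis unfolding E_def using fd D0(3) by blast
  qed
  interpret refinement L K E S D F xu xv M w
  proof
    show "shift_invariant S" using S by (simp add: admissible_def)
    show "irreducible_shift D S" by (rule D)
    show "(\<Sum>e\<in>E. 4 * 2 ^ height e) \<le> M" by (simp add: M_def)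
  qed (use L Esym F xu xv w place in \<open>auto simp: E_def\<close>)
  have "\<exists>z\<in>refined. \<forall>p x. (p, x) \<in> {} \<longrightarrow> z p = x p"
    using refined_irreducible unfolding irreducible_shift_def by blast
  then have adm: "admissible refined"
    using refined_invariant refined_irreducible unfolding admissible_def by blast
  have sub: "refined \<subseteq> S" by (auto simp: refined_def)
  show ?thesis by (rule that[OF sub adm refined_solves])
qed

section \<open>Systems with transitive diagonal points\<close>

text \<open>Identifies the negative iterates, which \<open>iterz\<close> takes from
  \<open>inv_into\<close>, with those of an action of the integers.\<close>

lemma iterz_action:
  fixes a :: "int \<Rightarrow> 'a \<Rightarrow> 'a"
  assumes a0: "\<And>x. x \<in> X \<Longrightarrow> a 0 x = x"
    and add: "\<And>m n x. x \<in> X \<Longrightarrow> a (m + n) x = a m (a n x)"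
    and cl: "\<And>n x. x \<in> X \<Longrightarrow> a n x \<in> X"
    and T: "\<And>x. x \<in> X \<Longrightarrow> T x = a 1 x"
    and x: "x \<in> X"
  shows "iterz X T n x = a n x"
proof -
  have pos: "(T ^^ k) x = a (int k) x" for k
  proof (induction k)
    case (Suc k)
    have "(T ^^ Suc k) x = T (a (int k) x)" using Suc by simp
    also have "\<dots> = a (1 + int k) x" using T cl add x by simp
    finally show ?case by simp
  qed (use a0 x in simp)
  have inv: "inv_into X T y = a (-1) y" if "y \<in> X" for y
  proof (rule inv_into_f_eq)
    show "inj_on T X"
    proof (rule inj_onI)
      fix y z assume yz: "y \<in> X" "z \<in> X" "T y = T z"
      have "a (-1) (a 1 y) = y" "a (-1) (a 1 z) = z" using yz a0 add[symmetric] by simp_all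
      then show "y = z" using yz T by metis
    qed
    show "T (a (-1) y) = y" using that a0 cl T add[of y 1 "-1"] by simp
  qed (use that cl in auto)
  have neg: "(inv_into X T ^^ k) x = a (- int k) x" for k
  proof (induction k)
    case (Suc k)
    have "(inv_into X T ^^ Suc k) x = inv_into X T (a (- int k) x)" using Suc by simp
    also have "\<dots> = a (- 1 + - int k) x"
      using inv[OF cl[OF x]] add[OF x, of "- 1" "- int k"] by (simp only:)
    finally show ?case by simp
  qed (use a0 x in simp)
  show ?thesis using pos[of "nat n"] neg[of "nat (- n)"] by (simp add: iterz_def)
qed

lemma funpow_two: "(T ^^ 2) y = T (T y)"
  by (simp add: numeral_2_eq_2)

text \<open>Collects what the dynamical conclusions need, with \<open>a n\<close> as the powers of
  \<open>T = a 1\<close>: \<open>g_conj\<close> makes the graph of \<open>g\<close> invariant under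
  \<open>prod_map_12 T\<close>, and \<open>dense\<close> is transitivity of the diagonal
  points.\<close>

locale double_transitive =
  fixes X :: "'a::metric_space set" and a :: "int \<Rightarrow> 'a \<Rightarrow> 'a" and g :: "'a \<Rightarrow> 'a"
  assumes compact_X: "compact X"
    and a0: "x \<in> X \<Longrightarrow> a 0 x = x"
    and a_add: "x \<in> X \<Longrightarrow> a (m + n) x = a m (a n x)"
    and a_in: "x \<in> X \<Longrightarrow> a n x \<in> X"
    and a_cont: "continuous_on X (a n)"
    and g_in: "x \<in> X \<Longrightarrow> g x \<in> X" and g_cont: "continuous_on X g"
    and g_conj: "x \<in> X \<Longrightarrow> a (2 * n) (g x) = g (a n x)"
    and dense: "\<lbrakk>x \<in> X; openin (top_of_set X) U; U \<noteq> {}; openin (top_of_set X) V; V \<noteq> {}\<rbrakk>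
      \<Longrightarrow> \<exists>n. a n x \<in> U \<and> a (2 * n) x \<in> V"
    and nontrivial: "\<exists>y\<in>X. \<exists>z\<in>X. y \<noteq> z"
begin

lemma iterz_a: "x \<in> X \<Longrightarrow> iterz X (a 1) n x = a n x"
  using a0 a_add a_in by (rule iterz_action) simp_all

lemma tds_a: "tds X (a 1)"
proof -
  have inv: "a (-1) (a 1 x) = x" "a 1 (a (-1) x) = x" if "x \<in> X" for x
    using a_add[OF that, of "-1" 1] a_add[OF that, of 1 "-1"] a0[OF that] by simp_all
  have "homeomorphism X X (a 1) (a (-1))"
    using a_cont a_in inv by (intro homeomorphismI) auto
  then show ?thesis using compact_X nontrivial unfolding tds_def by blast
qed

lemma openin_preimage: "openin (top_of_set X) V \<Longrightarrow> openin (top_of_set X) {x\<in>X. a n x \<in> V}"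
  using continuous_openin_preimage[OF a_cont[of n], of X V] a_in by (auto simp: vimage_def Int_def)

lemma preimage_nonempty:
  assumes "openin (top_of_set X) V" "V \<noteq> {}"
  shows "{x\<in>X. a n x \<in> V} \<noteq> {}"
proof -
  obtain v where v: "v \<in> V" using assms by blast
  then have vX: "v \<in> X" using openin_imp_subset[OF assms(1)] by blast
  have "a n (a (- n) v) = v" using a_add[OF vX, of n "- n"] a0[OF vX] by simp
  then show ?thesis using a_in[OF vX, of "- n"] v by force
qed

lemma closure_eqI:
  assumes S: "S \<subseteq> Y" "closed Y" and d: "\<And>y W. y \<in> Y \<Longrightarrow> open W \<Longrightarrow> y \<in> W \<Longrightarrow> \<exists>s\<in>S. s \<in> W"
  shows "closure S = Y"
proof
  show "closure S \<subseteq> Y" using S by (rule closure_minimal)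
  show "Y \<subseteq> closure S"
  proof
    fix y assume "y \<in> Y"
    then show "y \<in> closure S" using d unfolding closure_iff_nhds_not_empty by blast
  qed
qed

text \<open>The case \<open>V = X\<close> of \<open>dense\<close>.\<close>

lemma minimal_a: "minimal_system X (a 1)"
  unfolding minimal_system_def
proof (intro conjI ballI tds_a)
  fix x assume x: "x \<in> X"
  have orb: "orbit X (a 1) x = range (\<lambda>n. a n x)" using iterz_a[OF x] by (simp add: orbit_def)
  show "closure (orbit X (a 1) x) = X" unfolding orb
  proof (rule closure_eqI)
    fix y W assume y: "y \<in> X" "open W" "y \<in> W"
    have "openin (top_of_set X) (X \<inter> W)" using y(2) by (rule openin_open_Int)
    moreover have "openin (top_of_set X) X" by simp
    ultimately obtain n where "a n x \<in> X \<inter> W" using dense[OF x, of "X \<inter> W" X] y x by blast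
    then show "\<exists>s\<in>range (\<lambda>n. a n x). s \<in> W" by blast
  qed (use a_in[OF x] compact_X compact_imp_closed in auto)
qed

lemma iterz_prod_map_12:
  assumes "x \<in> X" "y \<in> X"
  shows "iterz (X \<times> X) (prod_map_12 (a 1)) n (x, y) = (a n x, a (2 * n) y)"
proof -
  have "iterz (X \<times> X) (prod_map_12 (a 1)) n (x, y) = (\<lambda>n (x, y). (a n x, a (2 * n) y)) n (x, y)"
  proof (rule iterz_action)
    fix z assume z: "z \<in> X \<times> X"
    obtain p q where pq: "z = (p, q)" "p \<in> X" "q \<in> X" using z by blast
    show "prod_map_12 (a 1) z = (\<lambda>n (x, y). (a n x, a (2 * n) y)) 1 z"
      using pq a_add[of q 1 1] by (simp add: prod_map_12_def funpow_two)
  next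
    fix m n z assume z: "z \<in> X \<times> X"
    obtain p q where pq: "z = (p, q)" "p \<in> X" "q \<in> X" using z by blast
    show "(case z of (x, y) \<Rightarrow> (a (m + n) x, a (2 * (m + n)) y)) =
       (case case z of (x, y) \<Rightarrow> (a n x, a (2 * n) y) of (x, y) \<Rightarrow> (a m x, a (2 * m) y))"
      using pq a_add by (simp add: distrib_left)
  qed (use assms a0 a_in in auto)
  then show ?thesis by simp
qed

lemma orbit_prod_map_12:
  "x \<in> X \<Longrightarrow> y \<in> X \<Longrightarrow> orbit (X \<times> X) (prod_map_12 (a 1)) (x, y) = range (\<lambda>n. (a n x, a (2 * n) y))"
  by (simp add: orbit_def iterz_prod_map_12)

lemma closed_XX: "closed (X \<times> X)"
  using compact_X by (intro compact_imp_closed compact_Times)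

lemma closure_diagonal_orbit:
  assumes x: "x \<in> X"
  shows "closure (orbit (X \<times> X) (prod_map_12 (a 1)) (x, x)) = X \<times> X"
  unfolding orbit_prod_map_12[OF x x]
proof (rule closure_eqI)
  fix z W assume z: "z \<in> X \<times> X" "open W" "z \<in> W"
  obtain A B where AB: "open A" "open B" "z \<in> A \<times> B" "A \<times> B \<subseteq> W"
    using open_prod_elim[OF z(2,3)] by blast
  have "openin (top_of_set X) (X \<inter> A)" "openin (top_of_set X) (X \<inter> B)"
    using AB by (auto intro: openin_open_Int)
  then obtain n where "a n x \<in> X \<inter> A" "a (2 * n) x \<in> X \<inter> B"
    using dense[OF x, of "X \<inter> A" "X \<inter> B"] z AB(3) by blast
  then show "\<exists>s\<in>range (\<lambda>n. (a n x, a (2 * n) x)). s \<in> W" using AB(4) by blast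
qed (use a_in[OF x] closed_XX in auto)

lemma diagonal_transitive: "x \<in> X \<Longrightarrow> transitive_point (X \<times> X) (prod_map_12 (a 1)) (x, x)"
  by (simp add: transitive_point_def closure_diagonal_orbit)

text \<open>If \<open>(x, x)\<close> were minimal, the orbit of \<open>(x, g x)\<close> would be
  dense as well; it stays in the graph of \<open>g\<close>, so every point of \<open>X\<close> would
  equal \<open>g x\<close>.\<close>

lemma diagonal_not_minimal:
  assumes x: "x \<in> X"
  shows "\<not> minimal_point (X \<times> X) (prod_map_12 (a 1)) (x, x)"
proof
  assume m: "minimal_point (X \<times> X) (prod_map_12 (a 1)) (x, x)"
  \<comment> \<open>The graph of \<open>g\<close>, written with \<open>dist\<close> to exhibit it as
    a closed preimage.\<close>
  define G where "G = {z\<in>X \<times> X. dist (snd z) (g (fst z)) \<in> {0}}"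
  have "continuous_on (X \<times> X) (\<lambda>z. dist (snd z) (g (fst z)))"
    by (intro continuous_intros continuous_on_compose2[OF g_cont]) auto
  then have "closed G"
    unfolding G_def using continuous_closed_preimage[OF _ closed_XX closed_singleton, of "\<lambda>z. dist (snd z) (g (fst z))" 0]
    by (simp add: vimage_def Int_def)
  moreover have "orbit (X \<times> X) (prod_map_12 (a 1)) (x, g x) \<subseteq> G"
    unfolding orbit_prod_map_12[OF x g_in[OF x]] g_conj[OF x]
    using a_in[OF x] g_in[OF a_in[OF x]] by (auto simp: G_def)
  ultimately have "closure (orbit (X \<times> X) (prod_map_12 (a 1)) (x, g x)) \<subseteq> G"
    by (simp add: closure_minimal)
  moreover have "closure (orbit (X \<times> X) (prod_map_12 (a 1)) (x, g x)) = X \<times> X"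
    using m x g_in[OF x] unfolding minimal_point_def closure_diagonal_orbit[OF x] by blast
  ultimately have "y = g x" if "y \<in> X" for y using x that by (auto simp: G_def)
  then show False using nontrivial by metis
qed

text \<open>Take \<open>l0\<close> leading from a nonempty open part \<open>E\<close> of
  \<open>A\<close> into \<open>B\<close>, then \<open>x\<close> and \<open>p\<close> with
  \<open>x\<close> and \<open>a p x\<close> in \<open>E\<close> and \<open>a (l0 + 2 * p) x\<close>
  in \<open>C\<close>. The time \<open>l0 + p\<close> takes \<open>x\<close> into \<open>B\<close>
  and \<open>a p x\<close> into \<open>C\<close>.\<close>

lemma return_pair:
  assumes A: "openin (top_of_set X) A" "A \<noteq> {}" and B: "openin (top_of_set X) B" "B \<noteq> {}"
    and C: "openin (top_of_set X) C" "C \<noteq> {}"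
  shows "\<exists>m. (\<exists>x\<in>A. a m x \<in> B) \<and> (\<exists>y\<in>A. a m y \<in> C)"
proof -
  have AX: "A \<subseteq> X" using A openin_imp_subset by blast
  obtain x0 where x0: "x0 \<in> A" using A by blast
  then have x0X: "x0 \<in> X" using AX by blast
  obtain l0 where l0: "a l0 x0 \<in> A" "a (2 * l0) x0 \<in> B" using dense[OF x0X A B] by blast
  define E where "E = A \<inter> {x\<in>X. a l0 x \<in> B}"
  have "a l0 x0 \<in> E" using l0 a_in[OF x0X] a_add[OF x0X, of l0 l0] by (simp add: E_def)
  then have E: "openin (top_of_set X) E" "E \<noteq> {}"
    using A openin_preimage[OF B(1)] by (auto simp: E_def)
  obtain x where x: "x \<in> E" using E by blast
  then have xX: "x \<in> X" using AX by (auto simp: E_def)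
  obtain p where p: "a p x \<in> E" "a (2 * p) x \<in> {x\<in>X. a l0 x \<in> C}"
    using dense[OF xX E openin_preimage[OF C(1)] preimage_nonempty[OF C]] by blast
  have px: "a p x \<in> X" using a_in[OF xX] .
  have "a (l0 + p) x \<in> B" using p(1) a_add[OF xX] by (simp add: E_def)
  moreover have "a (l0 + p) (a p x) = a l0 (a (2 * p) x)"
    using a_add[OF px, of l0 p] a_add[OF xX, of p p] by simp
  moreover have "x \<in> A" "a p x \<in> A" using x p(1) by (auto simp: E_def)
  moreover have "a l0 (a (2 * p) x) \<in> C" using p(2) by simp
  ultimately show ?thesis by (intro exI[of _ "l0 + p"] conjI bexI[of _ x] bexI[of _ "a p x"]) simp_all
qed

text \<open>The argument of Furstenberg and Petersen: it suffices that the return times of any \<open>A\<close> to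
  \<open>A\<close> and to \<open>B\<close> have a common element.\<close>

lemma weakly_mixing_a: "weakly_mixing X (a 1)"
  unfolding weakly_mixing_def top_transitive_def
proof (intro conjI tds_a allI impI, elim conjE)
  fix U V :: "('a \<times> 'a) set"
  assume UV: "openin (top_of_set (X \<times> X)) U" "openin (top_of_set (X \<times> X)) V" "U \<noteq> {}" "V \<noteq> {}"
  have box: "\<exists>A B. openin (top_of_set X) A \<and> A \<noteq> {} \<and> openin (top_of_set X) B \<and> B \<noteq> {} \<and> A \<times> B \<subseteq> W"
    if W: "openin (top_of_set (X \<times> X)) W" "W \<noteq> {}" for W
  proof -
    obtain O' where O: "open O'" "W = X \<times> X \<inter> O'" using W by (auto simp: openin_open)
    obtain z where z: "z \<in> W" using W by blast
    obtain A B where AB: "open A" "open B" "z \<in> A \<times> B" "A \<times> B \<subseteq> O'"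
      using open_prod_elim[OF O(1), of z] z O(2) by blast
    have "openin (top_of_set X) (X \<inter> A)" "openin (top_of_set X) (X \<inter> B)"
      using AB by (auto intro: openin_open_Int)
    moreover have "X \<inter> A \<noteq> {}" "X \<inter> B \<noteq> {}" using z AB(3) O(2) by auto
    moreover have "(X \<inter> A) \<times> (X \<inter> B) \<subseteq> W" using AB(4) O(2) by auto
    ultimately show ?thesis by blast
  qed
  obtain U1 U2 where U: "openin (top_of_set X) U1" "U1 \<noteq> {}" "openin (top_of_set X) U2" "U2 \<noteq> {}" "U1 \<times> U2 \<subseteq> U"
    using box[OF UV(1,3)] by blast
  obtain V1 V2 where V: "openin (top_of_set X) V1" "V1 \<noteq> {}" "openin (top_of_set X) V2" "V2 \<noteq> {}" "V1 \<times> V2 \<subseteq> V"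
    using box[OF UV(2,4)] by blast
  have UX: "U1 \<subseteq> X" using U openin_imp_subset by blast
  obtain x0 where x0: "x0 \<in> U1" using U by blast
  obtain k where k: "a k x0 \<in> U1" "a (2 * k) x0 \<in> U2" using dense[of x0 U1 U2] U x0 UX by blast
  \<comment> \<open>Points of \<open>A\<close> serve for both factors: \<open>x\<close> in
    \<open>A\<close> as the first coordinate, \<open>a k y\<close> with \<open>y\<close> in
    \<open>A\<close> as the second. Since \<open>a k\<close> commutes with \<open>a m\<close>, the
    target for \<open>y\<close> is the preimage of \<open>V2\<close> under
    \<open>a k\<close>.\<close>
  define A where "A = U1 \<inter> {x\<in>X. a k x \<in> U2}"
  have "a k x0 \<in> A" using k a_in[of x0 k] a_add[of x0 k k] x0 UX by (auto simp: A_def)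
  then have A: "openin (top_of_set X) A" "A \<noteq> {}" using U openin_preimage[OF U(3)] by (auto simp: A_def)
  obtain m x y where m: "x \<in> A" "a m x \<in> V1" "y \<in> A" "a m y \<in> {x\<in>X. a k x \<in> V2}"
    using return_pair[OF A V(1,2) openin_preimage[OF V(3)] preimage_nonempty[OF V(3,4)]] by blast
  have xX: "x \<in> X" and yX: "y \<in> X" using m by (auto simp: A_def)
  have comm: "a m (a k y) = a k (a m y)" using a_add[OF yX, of m k] a_add[OF yX, of k m] by (simp add: add.commute)
  have it: "iterz (X \<times> X) (\<lambda>(x, y). (a 1 x, a 1 y)) m (x, a k y) = (\<lambda>n (x, y). (a n x, a n y)) m (x, a k y)"
    by (rule iterz_action) (use a0 a_in a_add xX yX in auto)
  have "(x, a k y) \<in> U" "(a m x, a m (a k y)) \<in> V" "(x, a k y) \<in> X \<times> X"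
    using m U(5) V(5) comm a_in[OF yX] xX by (auto simp: A_def)
  then show "\<exists>n. U \<inter> {z\<in>X \<times> X. iterz (X \<times> X) (\<lambda>(x, y). (a 1 x, a 1 y)) n z \<in> V} \<noteq> {}"
    using it by (intro exI[of _ m]) auto
qed

end

section \<open>The subshift\<close>

text \<open>Lists keep the patterns countable, so that pairs of them can be enumerated.\<close>

type_synonym pattern = "(aff \<times> bool) list"

definition matches :: "config \<Rightarrow> pattern \<Rightarrow> bool" where
  "matches x us \<longleftrightarrow> (\<forall>(f, v)\<in>set us. x f = v)"

lemma matches_cong: "\<forall>f\<in>fst ` set us. x f = y f \<Longrightarrow> matches y us \<Longrightarrow> matches x us"
  unfolding matches_def by force

text \<open>One bound \<open>N\<close> for all of \<open>S\<close> makes the condition depend on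
  finitely many sites, which lets it pass to limits.\<close>

definition solves :: "config set \<Rightarrow> pattern \<Rightarrow> pattern \<Rightarrow> bool" where
  "solves S us vs \<longleftrightarrow>
     (\<exists>N. \<forall>x\<in>S. \<exists>n. \<bar>n\<bar> \<le> N \<and> matches (shift (tr n) x) us \<and> matches (shift (tr (2 * n)) x) vs)"

lemma refine_patterns:
  assumes S: "admissible S"
  shows "\<exists>S'. S' \<subseteq> S \<and> admissible S' \<and> ((\<exists>x\<in>S. matches x us) \<and> (\<exists>x\<in>S. matches x vs) \<longrightarrow> solves S' us vs)"
proof (cases "(\<exists>x\<in>S. matches x us) \<and> (\<exists>x\<in>S. matches x vs)")
  case True
  then obtain xu xv where x: "xu \<in> S" "matches xu us" "xv \<in> S" "matches xv vs" by blast
  define F where "F = fst ` set us \<union> fst ` set vs"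
  have "finite F" by (simp add: F_def)
  then obtain S' N where S': "S' \<subseteq> S" "admissible S'"
    and sol: "\<And>x. x \<in> S' \<Longrightarrow> \<exists>n. \<bar>n\<bar> \<le> N \<and> (\<forall>f\<in>F. x (tr n + f) = xu f) \<and> (\<forall>f\<in>F. x (tr (2 * n) + f) = xv f)"
    by (rule refine_admissible[OF S _ x(1,3)]) blast
  have "solves S' us vs" unfolding solves_def
  proof (rule exI[of _ N], rule ballI)
    fix y assume "y \<in> S'"
    then obtain n where n: "\<bar>n\<bar> \<le> N" "\<forall>f\<in>F. y (tr n + f) = xu f" "\<forall>f\<in>F. y (tr (2 * n) + f) = xv f"
      using sol by blast
    have "\<forall>f\<in>fst ` set us. shift (tr n) y f = xu f"
      using n(2) by (simp add: shift_def F_def)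
    then have "matches (shift (tr n) y) us" using x(2) by (rule matches_cong)
    moreover have "\<forall>f\<in>fst ` set vs. shift (tr (2 * n)) y f = xv f"
      using n(3) by (simp add: shift_def F_def)
    then have "matches (shift (tr (2 * n)) y) vs" using x(4) by (rule matches_cong)
    ultimately show "\<exists>n. \<bar>n\<bar> \<le> N \<and> matches (shift (tr n) y) us \<and> matches (shift (tr (2 * n)) y) vs"
      using n(1) by blast
  qed
  then show ?thesis using S' by blast
next
  case False then show ?thesis using S by blast
qed

text \<open>Step \<open>k\<close> treats the pair of patterns with code \<open>k\<close>. Once
  suffices, because patterns of the limit occur at every stage. The initial stage makes both symbols
  appear along every orbit.\<close>

lemma nested_admissible:
  obtains SS :: "nat \<Rightarrow> config set" where "\<And>k. admissible (SS k)" "\<And>k. SS (Suc k) \<subseteq> SS k"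
    "solves (SS 0) [(0, True)] [(0, False)]"
    "\<And>us vs. \<exists>k. (\<exists>x\<in>SS k. matches x us) \<and> (\<exists>x\<in>SS k. matches x vs) \<longrightarrow> solves (SS (Suc k)) us vs"
proof -
  have "matches (\<lambda>_. True) [(0, True)]" "matches (\<lambda>_. False) [(0, False)]" by (auto simp: matches_def)
  then obtain S0 where S0: "admissible S0" "solves S0 [(0, True)] [(0, False)]"
    using refine_patterns[OF admissible_UNIV, of "[(0, True)]" "[(0, False)]"] by blast
  define step where "step k S S' \<longleftrightarrow> S' \<subseteq> S \<and>
    (\<forall>us vs. from_nat k = (us, vs) \<longrightarrow> (\<exists>x\<in>S. matches x us) \<and> (\<exists>x\<in>S. matches x vs) \<longrightarrow> solves S' us vs)"
    for k :: nat and S S' :: "config set"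
  have "\<exists>SS. \<forall>n. (admissible (SS n) \<and> (n = 0 \<longrightarrow> SS n = S0)) \<and> step n (SS n) (SS (Suc n))"
  proof (rule dependent_nat_choice)
    fix S and n :: nat assume "admissible S \<and> (n = 0 \<longrightarrow> S = S0)"
    then have S: "admissible S" by blast
    obtain us vs :: pattern where n: "from_nat n = (us, vs)" by (rule prod.exhaust)
    show "\<exists>S'. (admissible S' \<and> (Suc n = 0 \<longrightarrow> S' = S0)) \<and> step n S S'"
      using refine_patterns[OF S, of us vs] unfolding step_def n by auto
  qed (use S0 in blast)
  then obtain SS where SS: "\<And>n. admissible (SS n)" "SS 0 = S0" "\<And>n. step n (SS n) (SS (Suc n))" by blast
  show ?thesis
  proof (rule that[of SS])
    fix us vs :: pattern
    have "from_nat (to_nat (us, vs)) = (us, vs)" by simp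
    then show "\<exists>k. (\<exists>x\<in>SS k. matches x us) \<and> (\<exists>x\<in>SS k. matches x vs) \<longrightarrow> solves (SS (Suc k)) us vs"
      using SS(3)[of "to_nat (us, vs)"] unfolding step_def by blast
  qed (use SS S0 in \<open>auto simp: step_def\<close>)
qed

section \<open>Configurations encoded as real sequences\<close>

lemma infinite_aff: "infinite (UNIV :: aff set)"
  using inj_tr by (metis finite_imageD finite_subset infinite_UNIV_int subset_UNIV)

definition site :: "nat \<Rightarrow> aff" where "site = from_nat_into UNIV"

lemma bij_site: "bij site"
  unfolding site_def using bij_betw_from_nat_into[of "UNIV :: aff set"] infinite_aff by simp

definition encode :: "config \<Rightarrow> nat \<Rightarrow> real" where "encode x i = of_bool (x (site i))"

definition act :: "aff \<Rightarrow> (nat \<Rightarrow> real) \<Rightarrow> nat \<Rightarrow> real" where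
  "act g f i = f (inv site (g + site i))"

lemma site_inv [simp]: "site (inv site p) = p" "inv site (site i) = i"
  using bij_site by (auto simp: bij_is_surj surj_f_inv_f bij_is_inj)

lemma act_encode: "act g (encode x) = encode (shift g x)"
  by (rule ext) (simp add: act_def encode_def shift_def)

lemma act_act: "act g (act h f) = act (h + g) f"
  by (rule ext) (simp add: act_def add.assoc)

lemma act_0: "act 0 f = f"
  by (rule ext) (simp add: act_def)

lemma continuous_on_act: "continuous_on X (act g)"
proof -
  have "continuous_on UNIV (\<lambda>f. act g f i)" for i
    unfolding act_def by (rule continuous_on_product_coordinates)
  then have "continuous_on UNIV (act g)" by (intro continuous_on_coordinatewise_then_product)
  then show ?thesis using continuous_on_subset by blast
qed

lemma inj_encode: "inj encode"
proof (rule injI, rule ext)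
  fix x y p assume "encode x = encode y"
  then have "encode x (inv site p) = encode y (inv site p)" by simp
  then show "x p = y p" by (simp add: encode_def of_bool_eq_iff)
qed

lemma range_encode: "range encode = (\<Pi>\<^sub>E i\<in>UNIV. {0, 1})"
proof
  show "range encode \<subseteq> (\<Pi>\<^sub>E i\<in>UNIV. {0, 1})" by (auto simp: encode_def)
  show "(\<Pi>\<^sub>E i\<in>UNIV. {0, 1}) \<subseteq> range encode"
  proof
    fix f :: "nat \<Rightarrow> real" assume f: "f \<in> (\<Pi>\<^sub>E i\<in>UNIV. {0, 1})"
    have "f = encode (\<lambda>p. f (inv site p) = 1)"
      using f by (auto simp: encode_def fun_eq_iff PiE_def Pi_def)
    then show "f \<in> range encode" by blast
  qed
qed

lemma compact_range_encode: "compact (range encode)"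
proof -
  have "compactin (product_topology (\<lambda>_::nat. euclidean) UNIV) (\<Pi>\<^sub>E i\<in>UNIV. {0, 1 :: real})"
    by (subst compactin_PiE) (auto simp: compactin_euclidean_iff finite_imp_compact)
  then show ?thesis unfolding range_encode by (simp add: euclidean_product_topology compactin_euclidean_iff)
qed

lemma open_fun_finite_support:
  fixes U :: "(nat \<Rightarrow> real) set"
  assumes "open U" "f \<in> U"
  obtains I where "finite I" "\<And>h. (\<And>i. i \<in> I \<Longrightarrow> h i = f i) \<Longrightarrow> h \<in> U"
proof -
  have "openin (product_topology (\<lambda>_::nat. euclidean) UNIV) U"
    using assms(1) by (simp add: euclidean_product_topology flip: open_openin)
  from product_topology_open_contains_basis[OF this assms(2)]
  obtain Y where Y: "f \<in> (\<Pi>\<^sub>E i\<in>UNIV. Y i)" "finite {i. Y i \<noteq> UNIV}" "(\<Pi>\<^sub>E i\<in>UNIV. Y i) \<subseteq> U" by auto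
  show ?thesis
  proof (rule that[OF Y(2)])
    fix h assume h: "\<And>i. i \<in> {i. Y i \<noteq> UNIV} \<Longrightarrow> h i = f i"
    have "h i \<in> Y i" for i using h[of i] Y(1) by (cases "Y i = UNIV") (auto simp: PiE_iff)
    then show "h \<in> U" using Y(3) by (auto simp: PiE_iff)
  qed
qed

text \<open>Finite patterns describe a neighbourhood basis of a configuration in the product
  topology.\<close>

lemma encode_in_closure_iff:
  "encode x \<in> closure (encode ` S) \<longleftrightarrow> (\<forall>us. matches x us \<longrightarrow> (\<exists>y\<in>S. matches y us))"
proof
  assume cl: "encode x \<in> closure (encode ` S)"
  show "\<forall>us. matches x us \<longrightarrow> (\<exists>y\<in>S. matches y us)"
  proof (intro allI impI)
    fix us assume us: "matches x us"
    define I where "I = inv site ` fst ` set us"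
    \<comment> \<open>Encoded values are \<open>0\<close> or \<open>1\<close>, so distance less than
      \<open>1\<close> forces equality.\<close>
    define W where "W = (\<Inter>i\<in>I. {f :: nat \<Rightarrow> real. \<bar>f i - encode x i\<bar> < 1})"
    have "open {f :: nat \<Rightarrow> real. \<bar>f i - encode x i\<bar> < 1}" for i
      by (intro open_Collect_less continuous_intros continuous_on_product_coordinates)
    then have "open W" unfolding W_def I_def by (intro open_INT) auto
    moreover have "encode x \<in> W" by (auto simp: W_def)
    ultimately obtain y where y: "y \<in> S" "encode y \<in> W"
      using cl unfolding closure_iff_nhds_not_empty by blast
    have "\<forall>p\<in>fst ` set us. y p = x p"
    proof
      fix p assume "p \<in> fst ` set us"
      then have "\<bar>encode y (inv site p) - encode x (inv site p)\<bar> < 1" using y(2) by (auto simp: W_def I_def)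
      then show "y p = x p" by (auto simp: encode_def of_bool_def split: if_splits)
    qed
    then have "matches y us" using us by (rule matches_cong)
    then show "\<exists>y\<in>S. matches y us" using y(1) by blast
  qed
next
  assume H: "\<forall>us. matches x us \<longrightarrow> (\<exists>y\<in>S. matches y us)"
  show "encode x \<in> closure (encode ` S)"
    unfolding closure_iff_nhds_not_empty
  proof (intro allI impI)
    fix A W assume W: "W \<subseteq> A" "open W" "encode x \<in> W"
    obtain I where I: "finite I" "\<And>h. (\<And>i. i \<in> I \<Longrightarrow> h i = encode x i) \<Longrightarrow> h \<in> W"
      using open_fun_finite_support[OF W(2,3)] by blast
    obtain js where js: "set js = I" using finite_list[OF I(1)] by blast
    define us where "us = map (\<lambda>i. (site i, x (site i))) js"
    have "matches x us" by (auto simp: matches_def us_def)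
    then obtain y where y: "y \<in> S" "matches y us" using H by blast
    then have "encode y \<in> W" using js by (intro I(2)) (auto simp: matches_def us_def encode_def)
    then show "encode ` S \<inter> A \<noteq> {}" using y(1) W(1) by blast
  qed
qed

theorem theoremA:
  shows "\<exists>(X :: (nat \<Rightarrow> real) set) T.
     minimal_system X T \<and> weakly_mixing X T
     \<and> \<not> (\<exists>x\<in>X. minimal_point (X \<times> X) (prod_map_12 T) (x, x))
     \<and> (\<forall>x\<in>X. transitive_point (X \<times> X) (prod_map_12 T) (x, x)
              \<and> \<not> minimal_point (X \<times> X) (prod_map_12 T) (x, x))"
proof -
  obtain SS :: "nat \<Rightarrow> config set" where adm: "\<And>k. admissible (SS k)" and dec: "\<And>k. SS (Suc k) \<subseteq> SS k"
    and sol0: "solves (SS 0) [(0, True)] [(0, False)]"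
    and sol: "\<And>us vs. \<exists>k. (\<exists>x\<in>SS k. matches x us) \<and> (\<exists>x\<in>SS k. matches x vs) \<longrightarrow> solves (SS (Suc k)) us vs"
    using nested_admissible by blast
  \<comment> \<open>The intersection of the closures of the \<open>SS k\<close>, expressed through
    patterns because the \<open>SS k\<close> need not be closed.\<close>
  define Xc where "Xc = {x. \<forall>k us. matches x us \<longrightarrow> (\<exists>y\<in>SS k. matches y us)}"
  define X where "X = encode ` Xc"
  have clos: "closure (encode ` SS k) \<subseteq> range encode" for k
    using compact_range_encode by (intro closure_minimal compact_imp_closed) auto
  have X_eq: "X = (\<Inter>k. closure (encode ` SS k))"
  proof
    show "X \<subseteq> (\<Inter>k. closure (encode ` SS k))" by (auto simp: X_def Xc_def encode_in_closure_iff)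
    show "(\<Inter>k. closure (encode ` SS k)) \<subseteq> X"
    proof
      fix f assume f: "f \<in> (\<Inter>k. closure (encode ` SS k))"
      then obtain x where "f = encode x" using clos[of 0] by blast
      then show "f \<in> X" using f by (auto simp: X_def Xc_def encode_in_closure_iff)
    qed
  qed
  have comp: "compact (closure (encode ` SS k))" for k
    using compact_range_encode clos[of k] by (metis closed_closure compact_Int_closed inf.absorb_iff2)
  have compact_X: "compact X"
  proof -
    have "X = closure (encode ` SS 0) \<inter> X" unfolding X_eq by blast
    moreover have "closed X" unfolding X_eq by (intro closed_INT) auto
    ultimately show ?thesis using comp[of 0] compact_Int_closed by metis
  qed
  have mono: "SS n \<subseteq> SS m" if "m \<le> n" for m n using dec lift_Suc_antimono_le[of SS] that by blast
  \<comment> \<open>Nonemptiness by compactness: the stages decrease, so finitely many of them share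
    a point.\<close>
  have "range encode \<inter> (\<Inter>k\<in>UNIV. closure (encode ` SS k)) \<noteq> {}"
  proof (rule compact_imp_fip_image[OF compact_range_encode])
    fix I :: "nat set" assume I: "finite I"
    then obtain m where m: "\<forall>i\<in>I. i \<le> m" using finite_nat_set_iff_bounded_le by blast
    obtain x where x: "x \<in> SS m" using adm[of m] unfolding admissible_def by blast
    have "encode x \<in> closure (encode ` SS i)" if "i \<in> I" for i
    proof -
      have "x \<in> SS i" using mono[of i m] m that x by blast
      then show ?thesis using closure_subset[of "encode ` SS i"] by blast
    qed
    then show "range encode \<inter> (\<Inter>i\<in>I. closure (encode ` SS i)) \<noteq> {}" by blast
  qed auto
  then have "X \<noteq> {}" unfolding X_eq by blast
  have Xc_shift: "shift g x \<in> Xc" if x: "x \<in> Xc" for g x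
    unfolding Xc_def
  proof (intro CollectI allI impI)
    fix k us assume us: "matches (shift g x) us"
    define vs where "vs = map (\<lambda>(f, v). (g + f, v)) us"
    have m: "matches y vs \<longleftrightarrow> matches (shift g y) us" for y
      by (auto simp: vs_def matches_def shift_def)
    obtain y where "y \<in> SS k" "matches y vs" using x us m unfolding Xc_def by blast
    then show "\<exists>y\<in>SS k. matches y us" using adm[of k] m unfolding admissible_def shift_invariant_def by blast
  qed
  have Xc_solves: "\<exists>n. matches (shift (tr n) x) us \<and> matches (shift (tr (2 * n)) x) vs"
    if s: "solves (SS k) us vs" and x: "x \<in> Xc" for k us vs x
  proof -
    obtain N where N: "\<And>y. y \<in> SS k \<Longrightarrow> \<exists>n. \<bar>n\<bar> \<le> N \<and> matches (shift (tr n) y) us \<and> matches (shift (tr (2 * n)) y) vs"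
      using s unfolding solves_def by blast
    \<comment> \<open>All sites inspected for any admissible \<open>n\<close>; an element of
      \<open>SS k\<close> agreeing with \<open>x\<close> on \<open>P\<close> transfers its solution
      to \<open>x\<close>.\<close>
    define P where "P = (\<Union>n\<in>{- N..N}. (\<lambda>f. tr n + f) ` fst ` set us \<union> (\<lambda>f. tr (2 * n) + f) ` fst ` set vs)"
    have "finite P" by (simp add: P_def)
    then obtain ps where ps: "set ps = P" using finite_list by blast
    have "matches x (map (\<lambda>p. (p, x p)) ps)" by (auto simp: matches_def)
    then obtain y where y: "y \<in> SS k" "matches y (map (\<lambda>p. (p, x p)) ps)" using x unfolding Xc_def by blast
    then have yx: "y p = x p" if "p \<in> P" for p using that ps by (auto simp: matches_def)
    obtain n where n: "\<bar>n\<bar> \<le> N" "matches (shift (tr n) y) us" "matches (shift (tr (2 * n)) y) vs" using N[OF y(1)] by blast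
    have nN: "n \<in> {- N..N}" using n(1) by auto
    have "\<forall>f\<in>fst ` set us. shift (tr n) x f = shift (tr n) y f"
    proof
      fix f assume "f \<in> fst ` set us"
      then have "tr n + f \<in> P" unfolding P_def using nN by blast
      then show "shift (tr n) x f = shift (tr n) y f" by (simp add: shift_def yx)
    qed
    then have "matches (shift (tr n) x) us" using n(2) by (rule matches_cong)
    moreover have "\<forall>f\<in>fst ` set vs. shift (tr (2 * n)) x f = shift (tr (2 * n)) y f"
    proof
      fix f assume "f \<in> fst ` set vs"
      then have "tr (2 * n) + f \<in> P" unfolding P_def using nN by blast
      then show "shift (tr (2 * n)) x f = shift (tr (2 * n)) y f" by (simp add: shift_def yx)
    qed
    then have "matches (shift (tr (2 * n)) x) vs" using n(3) by (rule matches_cong)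
    ultimately show ?thesis by blast
  qed
  \<comment> \<open>The exponent is \<open>-1\<close> because \<open>act\<close> reverses
    composition: the required relation becomes
    \<open>Aff 0 (-1) + tr (2 * n) = tr n + Aff 0 (-1)\<close>.\<close>
  interpret double_transitive X "\<lambda>n. act (tr n)" "act (Aff 0 (-1))"
  proof
    show "compact X" by (rule compact_X)
    show "act (tr 0) f = f" for f by (simp add: act_0)
    show "act (tr (m + n)) f = act (tr m) (act (tr n) f)" for m n f
      unfolding act_act by (simp add: add.commute flip: tr_add)
    show "act (tr n) f \<in> X" if "f \<in> X" for n f using that Xc_shift by (auto simp: X_def act_encode)
    show "act (Aff 0 (- 1)) f \<in> X" if "f \<in> X" for f using that Xc_shift by (auto simp: X_def act_encode)
    show "continuous_on X (act (tr n))" "continuous_on X (act (Aff 0 (- 1)))" for n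
      by (rule continuous_on_act)+
    show "act (tr (2 * n)) (act (Aff 0 (- 1)) f) = act (Aff 0 (- 1)) (act (tr n) f)" for n f
      unfolding act_act by (simp add: tr_def)
    show "\<exists>y\<in>X. \<exists>z\<in>X. y \<noteq> z"
    proof -
      obtain x where x: "x \<in> Xc" using \<open>X \<noteq> {}\<close> by (auto simp: X_def)
      obtain n where n: "matches (shift (tr n) x) [(0, True)]" "matches (shift (tr (2 * n)) x) [(0, False)]"
        using Xc_solves[OF sol0 x] by blast
      have "shift (tr n) x \<noteq> shift (tr (2 * n)) x" using n by (auto simp: matches_def)
      then have "encode (shift (tr n) x) \<noteq> encode (shift (tr (2 * n)) x)" using inj_encode by (simp add: inj_eq)
      then show ?thesis using Xc_shift[OF x] unfolding X_def by blast
    qed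
    fix f U V assume f: "f \<in> X" and UV: "openin (top_of_set X) U" "U \<noteq> {}" "openin (top_of_set X) V" "V \<noteq> {}"
    \<comment> \<open>Every nonempty relatively open set contains a nonempty cylinder, which turns
      \<open>dense\<close> into a statement about pairs of patterns.\<close>
    have pat: "\<exists>y us. y \<in> Xc \<and> matches y us \<and> (\<forall>z\<in>Xc. matches z us \<longrightarrow> encode z \<in> W)"
      if W: "openin (top_of_set X) W" "W \<noteq> {}" for W
    proof -
      obtain O' where O: "open O'" "W = X \<inter> O'" using W by (auto simp: openin_open)
      obtain y where y: "y \<in> Xc" "encode y \<in> O'" using W O by (auto simp: X_def)
      obtain I where I: "finite I" "\<And>h. (\<And>i. i \<in> I \<Longrightarrow> h i = encode y i) \<Longrightarrow> h \<in> O'"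
        using open_fun_finite_support[OF O(1) y(2)] by blast
      obtain js where js: "set js = I" using finite_list[OF I(1)] by blast
      define us where "us = map (\<lambda>i. (site i, y (site i))) js"
      have "encode z \<in> W" if "z \<in> Xc" "matches z us" for z
      proof -
        have "encode z \<in> O'" using that js by (intro I(2)) (auto simp: matches_def us_def encode_def)
        then show ?thesis using O(2) that by (auto simp: X_def)
      qed
      moreover have "matches y us" by (auto simp: matches_def us_def)
      ultimately show ?thesis using y by blast
    qed
    obtain y us where us: "y \<in> Xc" "matches y us" "\<forall>z\<in>Xc. matches z us \<longrightarrow> encode z \<in> U" using pat[OF UV(1,2)] by blast
    obtain y' vs where vs: "y' \<in> Xc" "matches y' vs" "\<forall>z\<in>Xc. matches z vs \<longrightarrow> encode z \<in> V" using pat[OF UV(3,4)] by blast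
    \<comment> \<open>Patterns of points of \<open>Xc\<close> occur in every \<open>SS k\<close>, so
      the premise of \<open>sol\<close> holds at whichever step treats the pair.\<close>
    obtain k where "solves (SS (Suc k)) us vs" using sol[of us vs] us(1,2) vs(1,2) unfolding Xc_def by blast
    moreover obtain x where x: "x \<in> Xc" "f = encode x" using f by (auto simp: X_def)
    ultimately obtain n where "matches (shift (tr n) x) us" "matches (shift (tr (2 * n)) x) vs"
      using Xc_solves by blast
    then show "\<exists>n. act (tr n) f \<in> U \<and> act (tr (2 * n)) f \<in> V"
      using us(3) vs(3) Xc_shift[OF x(1)] unfolding x(2) act_encode by blast
  qed
  show ?thesis
    using minimal_a weakly_mixing_a diagonal_transitive diagonal_not_minimal
    by (intro exI[of _ X] exI[of _ "act (tr 1)"]) blast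
qed

end
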